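(* Let $\mathbb{F}_q$ be a finite field, let $k,m,n,r$ be positive integers with $r<\min\{m,n\}$, let $M_1,\dots,M_k$ be $m\times n$ matrices over $\mathbb{F}_q$, let $R=\mathbb{F}_q[x_1,\dots,x_k]$ and $\boldsymbol{M_x}=\sum_{i=1}^k x_iM_i$. Let $I_{\text{minors}}\subseteq R$, $I_{\text{KS}}\subseteq R_{\text{KS}}$, $I_{\text{supp}}^{\text{Gb}}\subseteq R_{\text{supp}}^{\text{Gb}}$, $I_{\text{supp}}\subseteq R_{\text{supp}}$, and the index sets $T_0,T_{i,j}$, be as defined in the context. Then: (1) $I_{\text{minors}}\subseteq I_{\text{KS}}\cap R$. Moreover, assume that $\Delta\neq 0$ is an $r$-minor of $\boldsymbol{M_x}$ with columns indexed by $\{n-r+1,\dots,n\}$. Then $(I_{\text{minors}})_\Delta=(I_{\text{KS}})_\Delta\cap R_\Delta$. (2) Let $\tilde{R}_{\text{supp}}=R[C_{T_{i,j}}:i\in[r],\,j\in[n-r]]\subseteq R_{\text{supp}}$ and let $\Phi:\tilde{R}_{\text{supp}}\to R_{\text{KS}}$ be the $\mathbb{F}_q$-algebra isomorphism which sends $x_i$ to $x_i$ for $i \in [k]$ and $C_{T_{i,j}}$ to $(-1)^iy_{i,j}$ for $i\in[r]$, $j\in[n-r]$. Then $\Phi(I_{\text{supp}}\cap\tilde{R}_{\text{supp}})=I_{\text{KS}}$. (3) For any $T\in\mathcal{P}_r(n)$, $C_T^{r+1}I_{\text{minors}}\subseteq I^{\text{Gb}}_{\text{supp}}$, and $$I_{\text{minors}}+\langle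 x_i^q-x_i:i\in[k]\rangle=\Big(\big(I^{\text{Gb}}_{\text{supp}}+\langle x_i^q-x_i,\;C_T^q-C_T:i\in[k],\,T\in\mathcal{P}_r(n)\rangle\big):\langle C_T:T\in\mathcal{P}_r(n)\rangle\Big)\cap R,$$ where on the right the sum of ideals and the ideal quotient are taken in $R^{\text{Gb}}_{\text{supp}}$, and on the left the ideal is taken in $R$.
   Context: Notation: $[n]=\{1,\dots,n\}$; $\mathcal{P}_r(n)$ is the collection of all $r$-element subsets of $[n]$; for a set $S$ of integers, $\text{sgn}(j,S)=\#\{i\in S:i<j\}$. Angle brackets denote the generated ideal. $u_{i,j}(\boldsymbol{x})\in R$ denotes the $(i,j)$-th entry of $\boldsymbol{M_x}$. An $r$-minor is the determinant of an $r\times r$ submatrix (rows and columns in increasing order). For an element $\Delta\in R$, the subscript $\Delta$ denotes localization at the powers of $\Delta$; thus $(I_{\text{minors}})_\Delta\subseteq R_\Delta$ and $(I_{\text{KS}})_\Delta\subseteq (R_{\text{KS}})_\Delta\supseteq R_\Delta$. For ideals $J,K$ of a ring $A$, $(J:K)=\{f\in A: fK\subseteq J\}$. - $I_{\text{minors}}\subseteq R$ is the ideal generated by all $(r+1)$-minors of $\boldsymbol{M_x}$. - $R_{\text{KS}}=R[y_{i,j}:i\in[r],j\in[n-r]]$ (a polynomial ring), and $I_{\text{KS}}\subseteq R_{\text{KS}}$ is the ideal generated by $f_{i,j}=u_{i,j}(\boldsymbol{x})+\sum_{l=1}^r u_{i,n-r+l}(\boldsymbol{x})\,y_{l,j}$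 for $i\in[m]$, $j\in[n-r]$. - $R_{\text{supp}}^{\text{Gb}}=R[C_T:T\in\mathcal{P}_r(n)]$ is the polynomial ring with one new variable $C_T$ for each $T\in\mathcal{P}_r(n)$, and $I_{\text{supp}}^{\text{Gb}}$ is the ideal generated by $h_{i,S}=\sum_{j\in S}(-1)^{\text{sgn}(j,S)}u_{i,j}(\boldsymbol{x})\,C_{S\setminus\{j\}}$ for $i\in[m]$, $S\in\mathcal{P}_{r+1}(n)$. - $T_0=\{n-r+1,\dots,n\}$, and for $i\in[r]$, $j\in[n-r]$, $T_{i,j}=\{j,n-r+1,\dots,n\}\setminus\{n-r+i\}$. - $R_{\text{supp}}=R[C_T:T\in\mathcal{P}_r(n)\setminus\{T_0\}]$, and $I_{\text{supp}}\subseteq R_{\text{supp}}$ is the ideal obtained by setting $C_{T_0}=1$ in all elements of $I_{\text{supp}}^{\text{Gb}}$. *)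

theory Defs
  imports
    "HOL-Library.Cardinality"
    "HOL-Library.Poly_Mapping"
    "HOL-Computational_Algebra.Fraction_Field"
    "HOL-Algebra.QuotRing"
    "Jordan_Normal_Form.Determinant"
    "Jordan_Normal_Form.DL_Submatrix"
begin

section \<open>Multivariate polynomials\<close>

text \<open>
  All polynomial rings of the development are realised as subrings of one polynomial ring, with
  variables \<open>x\<^sub>i\<close> (\<open>XV i\<close>), \<open>y\<^sub>i\<^sub>,\<^sub>j\<close> (\<open>YV i j\<close>) and \<open>C\<^sub>T\<close> (\<open>CV T\<close>). Inclusions such as that of \<open>R\<close> in
  \<open>R\<^sub>K\<^sub>S\<close> are then literal inclusions of carriers.
\<close>

datatype var = XV nat | YV nat nat | CV "nat set"

text \<open>
  The type of polynomials is an instance of \<^class>\<open>idom\<close> only if the variables are linearly ordered.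
  The choice of the order is irrelevant, so an arbitrary well-order is used.
\<close>

definition var_order :: "(var \<times> var) set"
  where "var_order = (SOME s. well_order_on UNIV s)"

lemma linear_order_var_order: "linear_order_on UNIV var_order"
proof -
  have "well_order_on (UNIV :: var set) var_order"
    unfolding var_order_def by (rule someI_ex) (rule well_order_on)
  then show ?thesis
    by (simp add: well_order_on_def)
qed

instantiation var :: linorder
begin

definition less_eq_var :: "var \<Rightarrow> var \<Rightarrow> bool"
  where "v \<le> w \<longleftrightarrow> (v, w) \<in> var_order"

definition less_var :: "var \<Rightarrow> var \<Rightarrow> bool"
  where "v < w \<longleftrightarrow> v \<le> w \<and> v \<noteq> (w :: var)"

instance
proof
  have lin: "refl var_order" "trans var_order" "antisym var_order" "total var_order"
    using linear_order_var_order
    by (simp_all add: linear_order_on_def partial_order_on_def preorder_on_def)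
  fix u v w :: var
  show "v \<le> v"
    using lin(1) by (simp add: less_eq_var_def refl_on_def)
  show "u \<le> w" if "u \<le> v" "v \<le> w"
    using lin(2) that unfolding less_eq_var_def by (rule transD)
  show antisym: "v = w" if "v \<le> w" "w \<le> v" for v w :: var
    using lin(3) that unfolding less_eq_var_def by (rule antisymD)
  show "v < w \<longleftrightarrow> v \<le> w \<and> \<not> w \<le> v"
    using antisym \<open>v \<le> v\<close> by (auto simp: less_var_def)
  show "v \<le> w \<or> w \<le> v"
    using lin(4) \<open>v \<le> v\<close> by (cases "v = w") (auto simp: less_eq_var_def total_on_def)
qed

end

type_synonym 'a mpoly = "(var \<Rightarrow>\<^sub>0 nat) \<Rightarrow>\<^sub>0 'a"

definition Const :: "'a::comm_ring_1 \<Rightarrow> 'a mpoly"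
  where "Const c = Poly_Mapping.single 0 c"

definition Var :: "var \<Rightarrow> 'a::comm_ring_1 mpoly"
  where "Var v = Poly_Mapping.single (Poly_Mapping.single v 1) 1"

definition vars :: "'a::comm_ring_1 mpoly \<Rightarrow> var set"
  where "vars p = (\<Union>mon \<in> Poly_Mapping.keys p. Poly_Mapping.keys mon)"

definition psubst :: "(var \<Rightarrow> 'a mpoly) \<Rightarrow> 'a::comm_ring_1 mpoly \<Rightarrow> 'a mpoly"
  where "psubst \<sigma> p = (\<Sum>mon \<in> Poly_Mapping.keys p.
    Const (Poly_Mapping.lookup p mon) *
      (\<Prod>v \<in> Poly_Mapping.keys mon. \<sigma> v ^ Poly_Mapping.lookup mon v))"

definition PolyR :: "var set \<Rightarrow> 'a::comm_ring_1 mpoly ring"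
  where "PolyR V =
    \<lparr>carrier = {p. vars p \<subseteq> V}, monoid.mult = (*), one = 1, ring.zero = 0, add = (+)\<rparr>"

lemma cring_PolyR: "cring (PolyR V :: 'a::comm_ring_1 mpoly ring)"
proof -
  have vars_add: "vars (p + q) \<subseteq> vars p \<union> vars q" for p q :: "'a mpoly"
    using Poly_Mapping.keys_add[of p q] by (auto simp: vars_def)
  have vars_mult: "vars (p * q) \<subseteq> vars p \<union> vars q" for p q :: "'a mpoly"
  proof
    fix v assume "v \<in> vars (p * q)"
    then obtain mon where mon: "mon \<in> Poly_Mapping.keys (p * q)" "v \<in> Poly_Mapping.keys mon"
      by (auto simp: vars_def)
    then obtain a b where ab: "a \<in> Poly_Mapping.keys p" "b \<in> Poly_Mapping.keys q" "mon = a + b"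
      using Poly_Mapping.keys_mult[of p q] by auto
    with mon(2) show "v \<in> vars p \<union> vars q"
      using Poly_Mapping.keys_add[of a b] by (auto simp: vars_def)
  qed
  have vars_uminus: "vars (- p) = vars p" for p :: "'a mpoly"
    by (simp add: vars_def Poly_Mapping.keys.rep_eq Poly_Mapping.uminus_poly_mapping.rep_eq)
  have vars_0: "vars (0 :: 'a mpoly) = {}" and vars_1: "vars (1 :: 'a mpoly) = {}"
    by (simp_all add: vars_def)
  have add: "p + q \<in> carrier (PolyR V)" and mult: "p * q \<in> carrier (PolyR V)"
    if "p \<in> carrier (PolyR V)" "q \<in> carrier (PolyR V)" for p q :: "'a mpoly"
    using vars_add[of p q] vars_mult[of p q] that by (auto simp: PolyR_def)
  have uminus: "- p \<in> carrier (PolyR V)" if "p \<in> carrier (PolyR V)" for p :: "'a mpoly"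
    using that by (simp add: PolyR_def vars_uminus)
  have zero: "0 \<in> carrier (PolyR V :: 'a mpoly ring)" and one: "1 \<in> carrier (PolyR V :: 'a mpoly ring)"
    by (simp_all add: PolyR_def vars_0 vars_1)
  have ops: "(\<otimes>\<^bsub>PolyR V\<^esub>) = ((*) :: 'a mpoly \<Rightarrow> _)" "(\<oplus>\<^bsub>PolyR V\<^esub>) = ((+) :: 'a mpoly \<Rightarrow> _)"
    "\<one>\<^bsub>PolyR V\<^esub> = (1 :: 'a mpoly)" "\<zero>\<^bsub>PolyR V\<^esub> = (0 :: 'a mpoly)"
    by (simp_all add: PolyR_def)
  show ?thesis
  proof (rule cringI)
    show "abelian_group (PolyR V :: 'a mpoly ring)"
    proof (rule abelian_groupI)
      fix p :: "'a mpoly" assume "p \<in> carrier (PolyR V)"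
      then show "\<exists>q\<in>carrier (PolyR V). q \<oplus>\<^bsub>PolyR V\<^esub> p = \<zero>\<^bsub>PolyR V\<^esub>"
        unfolding ops by (intro bexI[of _ "- p"] uminus) simp_all
    qed (simp_all add: ops add zero ac_simps)
    show "comm_monoid (PolyR V :: 'a mpoly ring)"
      by (rule comm_monoidI) (simp_all add: ops mult one ac_simps)
  qed (simp add: ops distrib_right)
qed

section \<open>Ideal quotients and localisation\<close>

definition ideal_quot :: "('c, 'd) ring_scheme \<Rightarrow> 'c set \<Rightarrow> 'c set \<Rightarrow> 'c set"
  where "ideal_quot A J K = {f \<in> carrier A. \<forall>g\<in>K. f \<otimes>\<^bsub>A\<^esub> g \<in> J}"

text \<open>
  For \<open>\<Delta> \<noteq> 0\<close>, the localisation at the powers of \<open>\<Delta>\<close> of a subring or of an ideal of a subring, inside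
  the fraction field of the domain of all polynomials.
\<close>

definition localise :: "'c::idom \<Rightarrow> 'c set \<Rightarrow> 'c fract set"
  where "localise \<Delta> S = {Fract f (\<Delta> ^ e) |f e. f \<in> S}"

section \<open>The matrix of linear forms\<close>

definition subsets_of_card :: "nat \<Rightarrow> nat \<Rightarrow> nat set set"  (\<open>\<P>\<close>)
  where "\<P> s n = {T. T \<subseteq> {1..n} \<and> card T = s}"

definition sgn_idx :: "nat \<Rightarrow> nat set \<Rightarrow> nat"
  where "sgn_idx j S = card {i \<in> S. i < j}"

definition Mx :: "nat \<Rightarrow> nat \<Rightarrow> nat \<Rightarrow> (nat \<Rightarrow> 'a mat) \<Rightarrow> 'a::comm_ring_1 mpoly mat"
  where "Mx k m n M = mat m n (\<lambda>(a, b). \<Sum>l = 1..k. Var (XV l) * Const (M l $$ (a, b)))"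

text \<open>
  Library matrices are indexed from \<open>0\<close>, whereas row and column indices, and sets of them, start
  at \<open>1\<close> in what follows; the shift is confined to the next two definitions. \<open>submatrix\<close> lists the
  selected rows and columns in increasing order.
\<close>

definition u_entry :: "nat \<Rightarrow> nat \<Rightarrow> nat \<Rightarrow> (nat \<Rightarrow> 'a mat) \<Rightarrow> nat \<Rightarrow> nat \<Rightarrow> 'a::comm_ring_1 mpoly"
  where "u_entry k m n M i j = Mx k m n M $$ (i - 1, j - 1)"

definition minor ::
    "nat \<Rightarrow> nat \<Rightarrow> nat \<Rightarrow> (nat \<Rightarrow> 'a mat) \<Rightarrow> nat set \<Rightarrow> nat set \<Rightarrow> 'a::comm_ring_1 mpoly"
  where "minor k m n M I J = det (submatrix (Mx k m n M) {a. Suc a \<in> I} {b. Suc b \<in> J})"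

definition T0 :: "nat \<Rightarrow> nat \<Rightarrow> nat set"
  where "T0 n r = {n - r + 1..n}"

definition Tij :: "nat \<Rightarrow> nat \<Rightarrow> nat \<Rightarrow> nat \<Rightarrow> nat set"
  where "Tij n r i j = insert j {n - r + 1..n} - {n - r + i}"

section \<open>Rings and ideals\<close>

definition R_base :: "nat \<Rightarrow> 'a::comm_ring_1 mpoly ring"
  where "R_base k = PolyR (XV ` {1..k})"

definition R_KS :: "nat \<Rightarrow> nat \<Rightarrow> nat \<Rightarrow> 'a::comm_ring_1 mpoly ring"
  where "R_KS k n r = PolyR (XV ` {1..k} \<union> {YV i j |i j. i \<in> {1..r} \<and> j \<in> {1..n - r}})"

definition R_suppGb :: "nat \<Rightarrow> nat \<Rightarrow> nat \<Rightarrow> 'a::comm_ring_1 mpoly ring"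
  where "R_suppGb k n r = PolyR (XV ` {1..k} \<union> CV ` \<P> r n)"

definition R_supp :: "nat \<Rightarrow> nat \<Rightarrow> nat \<Rightarrow> 'a::comm_ring_1 mpoly ring"
  where "R_supp k n r = PolyR (XV ` {1..k} \<union> CV ` (\<P> r n - {T0 n r}))"

definition R_supp_tilde :: "nat \<Rightarrow> nat \<Rightarrow> nat \<Rightarrow> 'a::comm_ring_1 mpoly ring"
  where "R_supp_tilde k n r =
    PolyR (XV ` {1..k} \<union> {CV (Tij n r i j) |i j. i \<in> {1..r} \<and> j \<in> {1..n - r}})"

lemma R_supp_tilde_subset:
  "carrier (R_supp_tilde k n r :: 'a::comm_ring_1 mpoly ring) \<subseteq> carrier (R_supp k n r)"
proof -
  have Tij: "Tij n r i j \<in> \<P> r n - {T0 n r}" if "i \<in> {1..r}" "j \<in> {1..n - r}" for i j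
  proof -
    from that have "card (Tij n r i j) = r"
      unfolding Tij_def by (subst card_Diff_singleton) auto
    moreover have "j \<in> Tij n r i j" "j \<notin> T0 n r"
      using that by (auto simp: Tij_def T0_def)
    then have "Tij n r i j \<noteq> T0 n r"
      by auto
    moreover have "Tij n r i j \<subseteq> {1..n}"
      using that by (auto simp: Tij_def)
    ultimately show ?thesis
      by (simp add: subsets_of_card_def)
  qed
  have sub: "{CV (Tij n r i j) |i j. i \<in> {1..r} \<and> j \<in> {1..n - r}} \<subseteq> CV ` (\<P> r n - {T0 n r})"
  proof (rule subsetI, elim CollectE exE conjE)
    fix v i j assume "v = CV (Tij n r i j)" "i \<in> {1..r}" "j \<in> {1..n - r}"
    then show "v \<in> CV ` (\<P> r n - {T0 n r})"
      using Tij[of i j] by (simp only: imageI)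
  qed
  have mono: "carrier (PolyR V :: 'a mpoly ring) \<subseteq> carrier (PolyR W)" if "V \<subseteq> W" for V W
    using that by (auto simp: PolyR_def)
  show ?thesis
    unfolding R_supp_tilde_def R_supp_def by (intro mono Un_mono order_refl sub)
qed

definition I_minors ::
    "nat \<Rightarrow> nat \<Rightarrow> nat \<Rightarrow> nat \<Rightarrow> (nat \<Rightarrow> 'a mat) \<Rightarrow> 'a::comm_ring_1 mpoly set"
  where "I_minors k m n r M =
    Idl\<^bsub>R_base k\<^esub> {minor k m n M I J |I J. I \<in> \<P> (r + 1) m \<and> J \<in> \<P> (r + 1) n}"

definition f_KS ::
    "nat \<Rightarrow> nat \<Rightarrow> nat \<Rightarrow> nat \<Rightarrow> (nat \<Rightarrow> 'a mat) \<Rightarrow> nat \<Rightarrow> nat \<Rightarrow> 'a::comm_ring_1 mpoly"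
  where "f_KS k m n r M i j =
    u_entry k m n M i j + (\<Sum>l = 1..r. u_entry k m n M i (n - r + l) * Var (YV l j))"

definition I_KS ::
    "nat \<Rightarrow> nat \<Rightarrow> nat \<Rightarrow> nat \<Rightarrow> (nat \<Rightarrow> 'a mat) \<Rightarrow> 'a::comm_ring_1 mpoly set"
  where "I_KS k m n r M =
    Idl\<^bsub>R_KS k n r\<^esub> {f_KS k m n r M i j |i j. i \<in> {1..m} \<and> j \<in> {1..n - r}}"

definition h_supp ::
    "nat \<Rightarrow> nat \<Rightarrow> nat \<Rightarrow> (nat \<Rightarrow> 'a mat) \<Rightarrow> nat \<Rightarrow> nat set \<Rightarrow> 'a::comm_ring_1 mpoly"
  where "h_supp k m n M i S =
    (\<Sum>j\<in>S. (- 1) ^ sgn_idx j S * u_entry k m n M i j * Var (CV (S - {j})))"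

definition I_suppGb ::
    "nat \<Rightarrow> nat \<Rightarrow> nat \<Rightarrow> nat \<Rightarrow> (nat \<Rightarrow> 'a mat) \<Rightarrow> 'a::comm_ring_1 mpoly set"
  where "I_suppGb k m n r M =
    Idl\<^bsub>R_suppGb k n r\<^esub> {h_supp k m n M i S |i S. i \<in> {1..m} \<and> S \<in> \<P> (r + 1) n}"

definition I_supp ::
    "nat \<Rightarrow> nat \<Rightarrow> nat \<Rightarrow> nat \<Rightarrow> (nat \<Rightarrow> 'a mat) \<Rightarrow> 'a::comm_ring_1 mpoly set"
  where "I_supp k m n r M =
    psubst (\<lambda>v. if v = CV (T0 n r) then 1 else Var v) ` I_suppGb k m n r M"

text \<open>The second conjunct is \<open>'a\<close>-linearity. The values of \<open>\<Phi>\<close> outside \<open>R_supp_tilde\<close> are irrelevant.\<close>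

definition is_Phi :: "nat \<Rightarrow> nat \<Rightarrow> nat \<Rightarrow> ('a::comm_ring_1 mpoly \<Rightarrow> 'a mpoly) \<Rightarrow> bool"
  where "is_Phi k n r \<Phi> \<longleftrightarrow>
    \<Phi> \<in> ring_iso (R_supp_tilde k n r) (R_KS k n r) \<and>
    (\<forall>c. \<Phi> (Const c) = Const c) \<and>
    (\<forall>i\<in>{1..k}. \<Phi> (Var (XV i)) = Var (XV i)) \<and>
    (\<forall>i\<in>{1..r}. \<forall>j\<in>{1..n - r}. \<Phi> (Var (CV (Tij n r i j))) = (- 1) ^ i * Var (YV i j))"

end

theory Submission
  imports Defs
begin

text \<open>
  Why the theorem holds. Write \<open>u\<close> for the matrix of linear forms. All the ideals that occur express
  that \<open>u\<close> has rank at most \<open>r\<close>, and they are compared through two specialisations of the variables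
  \<open>C\<^sub>T\<close> to maximal minors of a matrix with \<open>r\<close> rows.

  The relation \<open>h\<^sub>i\<^sub>,\<^sub>S\<close> is the Laplace expansion, along its first row, of a determinant with columns \<open>S\<close>
  whose first row is row \<open>i\<close> of \<open>u\<close> and whose remaining minors are the values of the \<open>C\<^sub>T\<close>. Hence it
  vanishes when the \<open>C\<^sub>T\<close> are the maximal minors of an \<open>r\<close>-rowed matrix and row \<open>i\<close> is a combination of
  its rows. Conversely, the relations for \<open>S = T \<union> {j}\<close> express \<open>C\<^sub>T u\<^sub>i\<^sub>,\<^sub>j\<close>, for every \<open>j\<close>, through the \<open>r\<close>
  entries \<open>u\<^sub>i\<^sub>,\<^sub>t\<close> with \<open>t \<in> T\<close>. So modulo the relations \<open>C\<^sub>T u\<close> is a product of a matrix with \<open>r\<close> columns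
  and one with \<open>r\<close> rows, its \<open>(r+1)\<close>-minors vanish, and the inclusion
  \<open>C\<^sub>T\<^sup>r\<^sup>+\<^sup>1 I\<^sub>m\<^sub>i\<^sub>n\<^sub>o\<^sub>r\<^sub>s \<subseteq> I\<^sub>s\<^sub>u\<^sub>p\<^sub>p\<^sup>G\<^sup>b\<close> of (3) follows (\<open>power_mult_I_minors_mem\<close>).

  The Kipnis-Shamir equations say that \<open>u\<close> is its last \<open>r\<close> columns times the matrix \<open>Q = (-Y | 1)\<close>.
  Sending \<open>C\<^sub>T\<close> to the maximal minor of \<open>Q\<close> with columns \<open>T\<close> maps \<open>I\<^sub>s\<^sub>u\<^sub>p\<^sub>p\<^sup>G\<^sup>b\<close> into \<open>I\<^sub>K\<^sub>S\<close>
  (\<open>KS_subst_I_suppGb\<close>), sends \<open>C\<close> at \<open>T\<^sub>0\<close> to \<open>1\<close>, and agrees with \<open>\<Phi>\<close> on the variables at the \<open>T\<^sub>i\<^sub>,\<^sub>j\<close>. This one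
  substitution gives the inclusion of (2) from left to right, and together with the inclusion of (3) at
  \<open>T\<^sub>0\<close> it gives \<open>I\<^sub>m\<^sub>i\<^sub>n\<^sub>o\<^sub>r\<^sub>s \<subseteq> I\<^sub>K\<^sub>S\<close>. For the other inclusion of (2), \<open>f\<^sub>i\<^sub>,\<^sub>j\<close> is the image of the relation with
  \<open>S = T\<^sub>0 \<union> {j}\<close>.

  For the localised equality in (1), solve the Kipnis-Shamir equations of the \<open>r\<close> rows of \<open>\<Delta>\<close> by
  Cramer's rule. At that solution \<open>f\<^sub>i\<^sub>,\<^sub>j\<close> becomes a bordered \<open>(r+1)\<close>-minor divided by \<open>\<Delta>\<close>, so \<open>I\<^sub>K\<^sub>S\<close> is sent
  into the localised ideal of minors while polynomials in the \<open>x\<^sub>i\<close> are fixed (\<open>cramer_eval_I_KS\<close>).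

  In the equality of (3), the field equation of \<open>C\<^sub>T\<close> makes \<open>C\<^sub>T\<close> congruent to arbitrarily high powers of
  itself, which absorbs the exponent \<open>r+1\<close> and yields one inclusion (\<open>C_mult_I_minors_mem\<close>). For the
  other, the left-hand side contains the field equations, so it consists of all polynomials that vanish
  at its points with coordinates in the finite field (\<open>finite_field_nullstellensatz\<close>). Above each such
  point there is a nonzero solution \<open>C\<close> of the support relations (\<open>ex_support_point\<close>); evaluating
  \<open>f C\<^sub>T\<close> there for some \<open>T\<close> with \<open>C\<^sub>T \<noteq> 0\<close> shows that \<open>f\<close> vanishes at the point.
\<close>

section \<open>Polynomials as functions of their variables\<close>

lemma poly_mapping_add_induct:
  assumes "P 0" "\<And>x c. P (Poly_Mapping.single x c)" "\<And>p q. P p \<Longrightarrow> P q \<Longrightarrow> P (p + q)"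
  shows "P (p :: 'b \<Rightarrow>\<^sub>0 'c::comm_monoid_add)"
proof (induction p rule: Poly_Mapping.update_induct)
  case const
  show ?case by (rule assms(1))
next
  case (update f x c)
  have "Poly_Mapping.update x c f = f + Poly_Mapping.single x c"
    using update(1) by (intro poly_mapping_eqI)
      (auto simp: lookup_update lookup_add lookup_single when_def in_keys_iff)
  then show ?case
    using update assms by metis
qed

text \<open>
  Evaluation in an arbitrary commutative ring rather than only in polynomials: the argument needs values in
  the field of coefficients, in the fraction field and in other polynomial rings.
\<close>

definition peval :: "('a::comm_ring_1 \<Rightarrow> 'b::comm_ring_1) \<Rightarrow> (var \<Rightarrow> 'b) \<Rightarrow> 'a mpoly \<Rightarrow> 'b"
  where "peval h \<sigma> p = (\<Sum>m \<in> Poly_Mapping.keys p. h (Poly_Mapping.lookup p m) *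
      (\<Prod>v \<in> Poly_Mapping.keys m. \<sigma> v ^ Poly_Mapping.lookup m v))"

lemma psubst_eq_peval: "psubst \<sigma> = peval Const \<sigma>"
  by (rule ext) (simp add: psubst_def peval_def)

lemma peval_cong:
  assumes "\<And>v. v \<in> vars p \<Longrightarrow> \<sigma> v = \<tau> v"
  shows "peval h \<sigma> p = peval h \<tau> p"
proof -
  have "\<sigma> v = \<tau> v" if "m \<in> Poly_Mapping.keys p" "v \<in> Poly_Mapping.keys m" for m v
    using that by (intro assms) (auto simp: vars_def)
  then show ?thesis
    unfolding peval_def by (intro sum.cong arg_cong2[where f = "(*)"] prod.cong) auto
qed

lemma keys_subset_prod:
  assumes "finite S" "Poly_Mapping.keys m \<subseteq> S"
  shows "(\<Prod>v \<in> Poly_Mapping.keys m. \<sigma> v ^ Poly_Mapping.lookup m v) =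
    (\<Prod>v \<in> S. (\<sigma> v :: 'b::comm_ring_1) ^ Poly_Mapping.lookup m v)"
  using assms by (intro prod.mono_neutral_left) (auto simp: in_keys_iff)

lemma monomial_eval_add:
  "(\<Prod>v \<in> Poly_Mapping.keys (a + b). (\<sigma> v :: 'b::comm_ring_1) ^ Poly_Mapping.lookup (a + b) v) =
    (\<Prod>v \<in> Poly_Mapping.keys a. \<sigma> v ^ Poly_Mapping.lookup a v) *
    (\<Prod>v \<in> Poly_Mapping.keys b. \<sigma> v ^ Poly_Mapping.lookup b v)"
proof -
  let ?S = "Poly_Mapping.keys a \<union> Poly_Mapping.keys b"
  have "Poly_Mapping.keys (a + b) \<subseteq> ?S"
    by (rule keys_add)
  then show ?thesis
    by (subst (1 2 3) keys_subset_prod[of ?S])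
      (auto simp: lookup_add power_add prod.distrib)
qed

context
  fixes h :: "'a::comm_ring_1 \<Rightarrow> 'b::comm_ring_1"
  assumes h: "comm_ring_hom h"
begin

interpretation h: comm_ring_hom h by (rule h)

lemma peval_superset:
  assumes "finite S" "Poly_Mapping.keys p \<subseteq> S"
  shows "peval h \<sigma> p = (\<Sum>m \<in> S. h (Poly_Mapping.lookup p m) *
      (\<Prod>v \<in> Poly_Mapping.keys m. \<sigma> v ^ Poly_Mapping.lookup m v))"
  unfolding peval_def using assms by (intro sum.mono_neutral_left) (auto simp: in_keys_iff)

lemma peval_single:
  "peval h \<sigma> (Poly_Mapping.single m c) =
    h c * (\<Prod>v \<in> Poly_Mapping.keys m. \<sigma> v ^ Poly_Mapping.lookup m v)"
  by (subst peval_superset[of "{m}"]) auto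

lemma peval_add: "peval h \<sigma> (p + q) = peval h \<sigma> p + peval h \<sigma> q"
proof -
  let ?S = "Poly_Mapping.keys p \<union> Poly_Mapping.keys q"
  have "Poly_Mapping.keys (p + q) \<subseteq> ?S"
    by (rule keys_add)
  then show ?thesis
    by (subst (1 2 3) peval_superset[of ?S])
      (auto simp: lookup_add h.hom_add distrib_right sum.distrib)
qed

lemma peval_zero: "peval h \<sigma> 0 = 0"
  by (simp add: peval_def)

lemma peval_mult: "peval h \<sigma> (p * q) = peval h \<sigma> p * peval h \<sigma> q"
proof (induction p rule: poly_mapping_add_induct)
  case (2 x c)
  show ?case
  proof (induction q rule: poly_mapping_add_induct)
    case (2 y d)
    show ?case
      by (simp only: mult_single peval_single monomial_eval_add h.hom_mult mult_ac)
  qed (simp_all add: peval_zero distrib_left peval_add)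
qed (simp_all add: peval_zero distrib_right peval_add)

lemma peval_Const: "peval h \<sigma> (Const c) = h c"
  by (simp add: Const_def peval_single)

lemma peval_Var: "peval h \<sigma> (Var v) = \<sigma> v"
  by (simp add: Var_def peval_single)

lemma comm_ring_hom_peval: "comm_ring_hom (peval h \<sigma>)"
proof
  show "peval h \<sigma> 1 = 1"
    using peval_Const[of \<sigma> 1] by (simp add: Const_def)
qed (simp_all add: peval_add peval_mult peval_zero)

end

lemma comm_ring_hom_Const: "comm_ring_hom (Const :: 'a::comm_ring_1 \<Rightarrow> 'a mpoly)"
  by standard (simp_all add: Const_def single_add mult_single)

lemma comm_ring_hom_psubst: "comm_ring_hom (psubst \<sigma>)"
  unfolding psubst_eq_peval by (rule comm_ring_hom_peval[OF comm_ring_hom_Const])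

lemmas psubst_Const = peval_Const[OF comm_ring_hom_Const, folded psubst_eq_peval]
lemmas psubst_Var = peval_Var[OF comm_ring_hom_Const, folded psubst_eq_peval]

lemma Var_power: "Var v ^ n = Poly_Mapping.single (Poly_Mapping.single v n) 1"
  by (induction n) (simp_all add: Var_def mult_single flip: single_add)

text \<open>
  This says that a polynomial is the sum of its terms, each a coefficient times a product of variables; it
  is the source of the induction rule for polynomials in a given set of variables.
\<close>

lemma psubst_Var_id: "psubst Var p = p"
proof (induction p rule: poly_mapping_add_induct)
  case 1
  show ?case by (simp add: psubst_def)
next
  case (2 m c)
  have prod: "(\<Prod>v\<in>S. Poly_Mapping.single (f v) (1::'a)) = Poly_Mapping.single (\<Sum>v\<in>S. f v) 1"
    if "finite S" for S :: "var set" and f :: "var \<Rightarrow> var \<Rightarrow>\<^sub>0 nat"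
    using that by (induction S rule: finite_induct) (simp_all add: mult_single)
  have "(\<Sum>v\<in>Poly_Mapping.keys m. Poly_Mapping.single v (Poly_Mapping.lookup m v)) = m"
    by (rule poly_mapping_eqI)
      (auto simp: Poly_Mapping.lookup_sum lookup_single when_def in_keys_iff)
  then show ?case
    unfolding psubst_eq_peval
    by (simp add: peval_single[OF comm_ring_hom_Const] Var_power prod Const_def mult_single)
next
  case (3 p q)
  then show ?case
    by (simp add: psubst_eq_peval peval_add[OF comm_ring_hom_Const])
qed

lemma vars_Const [simp]: "vars (Const c) = {}"
  by (simp add: vars_def Const_def)

lemma vars_Var [simp]: "vars (Var v :: 'a::comm_ring_1 mpoly) = {v}"
  by (simp add: vars_def Var_def)

lemma carrier_PolyR: "carrier (PolyR V) = {p. vars p \<subseteq> V}"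
  by (simp add: PolyR_def)

lemma PolyR_ops [simp]:
  "(\<otimes>\<^bsub>PolyR V\<^esub>) = (*)" "(\<oplus>\<^bsub>PolyR V\<^esub>) = (+)" "\<one>\<^bsub>PolyR V\<^esub> = 1" "\<zero>\<^bsub>PolyR V\<^esub> = 0"
  by (simp_all add: PolyR_def)

lemma vars_0 [simp]: "vars 0 = {}" and vars_1 [simp]: "vars 1 = {}"
  by (simp_all add: vars_def)

lemma vars_add_subset: "vars p \<subseteq> V \<Longrightarrow> vars q \<subseteq> V \<Longrightarrow> vars (p + q) \<subseteq> V"
  and vars_mult_subset: "vars p \<subseteq> V \<Longrightarrow> vars q \<subseteq> V \<Longrightarrow> vars (p * q) \<subseteq> V"
proof -
  interpret cring "PolyR V :: 'a mpoly ring" by (rule cring_PolyR)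
  show "vars p \<subseteq> V \<Longrightarrow> vars q \<subseteq> V \<Longrightarrow> vars (p + q) \<subseteq> V"
    "vars p \<subseteq> V \<Longrightarrow> vars q \<subseteq> V \<Longrightarrow> vars (p * q) \<subseteq> V"
    using a_closed[of p q] m_closed[of p q] by (simp_all add: carrier_PolyR)
qed

lemma vars_uminus [simp]: "vars (- p) = vars p"
  by (simp add: vars_def Poly_Mapping.keys.rep_eq Poly_Mapping.uminus_poly_mapping.rep_eq)

lemma vars_diff_subset: "vars p \<subseteq> V \<Longrightarrow> vars q \<subseteq> V \<Longrightarrow> vars (p - q) \<subseteq> V"
  using vars_add_subset[of p V "- q"] by simp

lemma vars_sum_subset: "(\<And>x. x \<in> A \<Longrightarrow> vars (f x) \<subseteq> V) \<Longrightarrow> vars (sum f A) \<subseteq> V"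
  by (induction A rule: infinite_finite_induct) (simp_all add: vars_add_subset)

lemma vars_prod_subset: "(\<And>x. x \<in> A \<Longrightarrow> vars (f x) \<subseteq> V) \<Longrightarrow> vars (prod f A) \<subseteq> V"
  by (induction A rule: infinite_finite_induct) (simp_all add: vars_mult_subset)

lemma vars_power_subset: "vars p \<subseteq> V \<Longrightarrow> vars (p ^ n) \<subseteq> V"
  by (induction n) (simp_all add: vars_mult_subset)

lemmas vars_subset_intros = vars_add_subset vars_mult_subset vars_diff_subset vars_sum_subset
  vars_prod_subset vars_power_subset

lemma PolyR_induct [consumes 1, case_names Const Var add mult]:
  assumes p: "vars p \<subseteq> V"
    and Const: "\<And>c. P (Const c)"
    and Var: "\<And>v. v \<in> V \<Longrightarrow> P (Var v)"
    and add: "\<And>p q. vars p \<subseteq> V \<Longrightarrow> vars q \<subseteq> V \<Longrightarrow> P p \<Longrightarrow> P q \<Longrightarrow> P (p + q)"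
    and mult: "\<And>p q. vars p \<subseteq> V \<Longrightarrow> vars q \<subseteq> V \<Longrightarrow> P p \<Longrightarrow> P q \<Longrightarrow> P (p * q)"
  shows "P p"
proof -
  have P0: "P 0" and P1: "P 1"
    using Const[of 0] Const[of 1] by (simp_all add: Const_def)
  have power: "vars (p ^ n) \<subseteq> V \<and> P (p ^ n)" if "vars p \<subseteq> V" "P p" for p n
    using that by (induction n) (simp_all add: P1 mult vars_mult_subset)
  have prod: "vars (prod f A) \<subseteq> V \<and> P (prod f A)"
    if "\<And>x. x \<in> A \<Longrightarrow> vars (f x) \<subseteq> V \<and> P (f x)" for f and A :: "var set"
    using that by (induction A rule: infinite_finite_induct)
      (simp_all add: P1 mult vars_mult_subset)
  have sum: "vars (sum f A) \<subseteq> V \<and> P (sum f A)"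
    if "\<And>x. x \<in> A \<Longrightarrow> vars (f x) \<subseteq> V \<and> P (f x)" for f and A :: "(var \<Rightarrow>\<^sub>0 nat) set"
    using that by (induction A rule: infinite_finite_induct)
      (simp_all add: P0 add vars_add_subset)
  have m: "vars (\<Prod>v\<in>Poly_Mapping.keys m. Var v ^ Poly_Mapping.lookup m v :: 'a mpoly) \<subseteq> V \<and>
      P (\<Prod>v\<in>Poly_Mapping.keys m. Var v ^ Poly_Mapping.lookup m v)"
    if "m \<in> Poly_Mapping.keys p" for m
  proof (intro prod power)
    fix v assume "v \<in> Poly_Mapping.keys m"
    then have "v \<in> V"
      using that p by (auto simp: vars_def)
    then show "vars (Var v :: 'a mpoly) \<subseteq> V" "P (Var v)"
      by (simp_all add: Var)
  qed
  have "vars (psubst Var p) \<subseteq> V \<and> P (psubst Var p)"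
    unfolding psubst_def
    by (intro sum conjI vars_mult_subset mult Const m[THEN conjunct1] m[THEN conjunct2]) simp_all
  then show ?thesis
    by (simp add: psubst_Var_id)
qed

text \<open>
  The universal property: a homomorphism is determined by the constants and the variables that occur.
\<close>

lemma hom_eq_on_PolyR:
  assumes f: "comm_ring_hom f" and g: "comm_ring_hom g"
    and p: "vars p \<subseteq> V" and Const: "\<And>c. f (Const c) = g (Const c)"
    and Var: "\<And>v. v \<in> V \<Longrightarrow> f (Var v) = g (Var v)"
  shows "f p = g p"
proof -
  interpret f: comm_ring_hom f by (rule f)
  interpret g: comm_ring_hom g by (rule g)
  from p show ?thesis
    by (induction rule: PolyR_induct) (simp_all add: Const Var f.hom_add f.hom_mult g.hom_add g.hom_mult)
qed

lemma psubst_psubst: "psubst \<sigma> (psubst \<tau> p) = psubst (\<lambda>v. psubst \<sigma> (\<tau> v)) p"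
proof -
  interpret s: comm_ring_hom "psubst \<sigma>" by (rule comm_ring_hom_psubst)
  interpret t: comm_ring_hom "psubst \<tau>" by (rule comm_ring_hom_psubst)
  have "comm_ring_hom (\<lambda>p. psubst \<sigma> (psubst \<tau> p))"
    by standard (simp_all add: s.hom_add t.hom_add s.hom_mult t.hom_mult)
  then show ?thesis
    by (rule hom_eq_on_PolyR[OF _ comm_ring_hom_psubst, of _ _ UNIV])
      (simp_all add: psubst_Const psubst_Var)
qed

lemma psubst_fix: "(\<And>v. v \<in> vars p \<Longrightarrow> \<sigma> v = Var v) \<Longrightarrow> psubst \<sigma> p = p"
  using peval_cong[of p \<sigma> Var Const] psubst_Var_id[of p] by (simp add: psubst_eq_peval)

lemma vars_psubst:
  assumes "\<And>v. v \<in> vars p \<Longrightarrow> vars (\<sigma> v) \<subseteq> V"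
  shows "vars (psubst \<sigma> p) \<subseteq> V"
  unfolding psubst_def
proof (intro vars_sum_subset vars_mult_subset vars_prod_subset vars_power_subset)
  show "vars (\<sigma> v) \<subseteq> V" if "m \<in> Poly_Mapping.keys p" "v \<in> Poly_Mapping.keys m" for m v
    using that by (intro assms) (auto simp: vars_def)
qed simp

section \<open>Ideals of polynomial rings\<close>

locale poly_ideal =
  fixes V :: "var set" and I :: "'a::comm_ring_1 mpoly set"
  assumes ideal: "ideal I (PolyR V)"
begin

sublocale ideal I "PolyR V" by (rule ideal)

lemma vars_mem: "p \<in> I \<Longrightarrow> vars p \<subseteq> V"
  using a_subset by (auto simp: carrier_PolyR)

lemma zero_mem: "0 \<in> I"
  using additive_subgroup.zero_closed[OF is_additive_subgroup] by simp

lemma add_mem: "p \<in> I \<Longrightarrow> q \<in> I \<Longrightarrow> p + q \<in> I"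
  using additive_subgroup.a_closed[OF is_additive_subgroup, of p q] by simp

lemma mult_mem: "vars a \<subseteq> V \<Longrightarrow> p \<in> I \<Longrightarrow> a * p \<in> I"
  using I_l_closed[of p a] by (simp add: carrier_PolyR)

lemma mult_mem_right: "vars a \<subseteq> V \<Longrightarrow> p \<in> I \<Longrightarrow> p * a \<in> I"
  using mult_mem[of a p] by (simp add: mult.commute)

lemma uminus_mem: "p \<in> I \<Longrightarrow> - p \<in> I"
  using mult_mem[of "- 1" p] by simp

lemma diff_mem: "p \<in> I \<Longrightarrow> q \<in> I \<Longrightarrow> p - q \<in> I"
  using add_mem[of p "- q"] uminus_mem[of q] by simp

lemma sum_mem: "(\<And>x. x \<in> A \<Longrightarrow> f x \<in> I) \<Longrightarrow> sum f A \<in> I"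
  by (induction A rule: infinite_finite_induct) (simp_all add: zero_mem add_mem)

lemma sign_mult_mem_iff: "(- 1) ^ n * p \<in> I \<longleftrightarrow> p \<in> I"
  using uminus_mem[of p] uminus_mem[of "- p"] by (cases "even n") auto

lemma mult_cong_mem:
  assumes "a - b \<in> I" "c - d \<in> I" "vars c \<subseteq> V" "vars b \<subseteq> V"
  shows "a * c - b * d \<in> I"
proof -
  have "a * c - b * d = c * (a - b) + b * (c - d)"
    by (simp add: algebra_simps)
  then show ?thesis
    using assms by (simp add: add_mem mult_mem)
qed

lemma prod_cong_mem:
  assumes "\<And>x. x \<in> A \<Longrightarrow> f x - g x \<in> I \<and> vars (f x) \<subseteq> V \<and> vars (g x) \<subseteq> V"
  shows "prod f A - prod g A \<in> I"
  using assms
  by (induction A rule: infinite_finite_induct)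
    (simp_all add: zero_mem mult_cong_mem vars_prod_subset)

lemma det_cong_mem:
  assumes A: "A \<in> carrier_mat n n" and B: "B \<in> carrier_mat n n"
    and "\<And>i j. i < n \<Longrightarrow> j < n \<Longrightarrow>
      A $$ (i, j) - B $$ (i, j) \<in> I \<and> vars (A $$ (i, j)) \<subseteq> V \<and> vars (B $$ (i, j)) \<subseteq> V"
  shows "det A - det B \<in> I"
  unfolding det_def'[OF A] det_def'[OF B] sum_subtractf[symmetric] right_diff_distrib[symmetric]
proof (intro sum_mem mult_mem prod_cong_mem)
  fix p i assume "p \<in> {p. p permutes {0..<n}}" "i \<in> {0..<n}"
  then show "A $$ (i, p i) - B $$ (i, p i) \<in> I \<and> vars (A $$ (i, p i)) \<subseteq> V \<and> vars (B $$ (i, p i)) \<subseteq> V"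
    using permutes_in_image[of p "{0..<n}" i] by (intro assms) auto
qed (auto simp: sign_def)

end

text \<open>
  Additive inverses come for free, since \<open>-1\<close> is an admissible multiplier.
\<close>

lemma idealI_PolyR:
  assumes "\<And>p. p \<in> I \<Longrightarrow> vars p \<subseteq> V" "0 \<in> I" "\<And>p q. p \<in> I \<Longrightarrow> q \<in> I \<Longrightarrow> p + q \<in> I"
    and mult: "\<And>a p. vars a \<subseteq> V \<Longrightarrow> p \<in> I \<Longrightarrow> a * p \<in> I"
  shows "ideal I (PolyR V :: 'a::comm_ring_1 mpoly ring)"
proof -
  interpret cring "PolyR V :: 'a mpoly ring" by (rule cring_PolyR)
  have minus: "\<ominus>\<^bsub>PolyR V\<^esub> p = - p" if "vars p \<subseteq> V" for p :: "'a mpoly"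
    using that by (intro minus_equality) (auto simp: carrier_PolyR)
  show ?thesis
  proof (rule idealI)
    show "subgroup I (add_monoid (PolyR V))"
    proof (rule add.subgroupI)
      show "\<ominus>\<^bsub>PolyR V\<^esub> a \<in> I" if "a \<in> I" for a
        using mult[of "- 1" a] that assms(1) by (simp add: minus)
    qed (use assms in \<open>auto simp: carrier_PolyR\<close>)
    show "x \<otimes>\<^bsub>PolyR V\<^esub> a \<in> I" "a \<otimes>\<^bsub>PolyR V\<^esub> x \<in> I" if "a \<in> I" "x \<in> carrier (PolyR V)" for a x
      using mult[of x a] that by (simp_all add: carrier_PolyR mult.commute[of a x])
  qed (rule ring_axioms)
qed

lemma poly_ideal_genideal:
  "(\<And>g. g \<in> G \<Longrightarrow> vars g \<subseteq> V) \<Longrightarrow> poly_ideal V (Idl\<^bsub>PolyR V\<^esub> G :: 'a::comm_ring_1 mpoly set)"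
  by (intro poly_ideal.intro ring.genideal_ideal cring.axioms(1) cring_PolyR)
    (auto simp: carrier_PolyR)

lemma genideal_mem:
  assumes "\<And>g. g \<in> G \<Longrightarrow> vars g \<subseteq> V" "g \<in> G"
  shows "g \<in> (Idl\<^bsub>PolyR V\<^esub> G :: 'a::comm_ring_1 mpoly set)"
  using ring.genideal_self[OF cring.axioms(1)[OF cring_PolyR], of G V] assms
  by (auto simp: carrier_PolyR)

lemma genideal_induct [consumes 1, case_names vars zero gen add mult]:
  assumes "p \<in> (Idl\<^bsub>PolyR V\<^esub> G :: 'a::comm_ring_1 mpoly set)" "\<And>g. g \<in> G \<Longrightarrow> vars g \<subseteq> V"
    and "P 0" "\<And>g. g \<in> G \<Longrightarrow> P g" "\<And>p q. P p \<Longrightarrow> P q \<Longrightarrow> P (p + q)"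
    and "\<And>a p. vars a \<subseteq> V \<Longrightarrow> P p \<Longrightarrow> P (a * p)"
  shows "P p"
proof -
  have "ideal {p. vars p \<subseteq> V \<and> P p} (PolyR V)"
    by (rule idealI_PolyR) (simp_all add: assms vars_add_subset vars_mult_subset)
  moreover have "G \<subseteq> {p. vars p \<subseteq> V \<and> P p}"
    using assms by auto
  ultimately have "Idl\<^bsub>PolyR V\<^esub> G \<subseteq> {p. vars p \<subseteq> V \<and> P p}"
    by (rule ring.genideal_minimal[OF cring.axioms(1)[OF cring_PolyR]])
  then show ?thesis
    using assms(1) by auto
qed

lemma poly_ideal_sum:
  assumes "poly_ideal V I" "poly_ideal V J"
  shows "poly_ideal V (I <+>\<^bsub>PolyR V\<^esub> J)"
  using assms unfolding poly_ideal_def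
  by (intro ring.add_ideals[OF cring.axioms(1)[OF cring_PolyR]])

lemma ideal_sum_eq: "I <+>\<^bsub>PolyR V\<^esub> J = {p + q | p q. p \<in> I \<and> q \<in> J}"
  by (auto simp: set_add_def' PolyR_ops)

section \<open>Minors indexed by sets\<close>

text \<open>
  Unlike a submatrix of a library matrix, this takes the entries from a function on arbitrary natural
  numbers, so that rows can be added under a fresh index and row and column sets can keep their own labels.
\<close>

definition set_minor :: "(nat \<Rightarrow> nat \<Rightarrow> 'b::comm_ring_1) \<Rightarrow> nat set \<Rightarrow> nat set \<Rightarrow> 'b"
  where "set_minor u I J = det (mat (card I) (card I) (\<lambda>(a, b). u (pick I a) (pick J b)))"

lemma pick_sgn_idx [simp]: "j \<in> S \<Longrightarrow> pick S (sgn_idx j S) = j"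
  by (simp add: sgn_idx_def pick_card_in_set)

lemma sgn_idx_pick: "n < card S \<Longrightarrow> sgn_idx (pick S n) S = n"
  by (simp add: sgn_idx_def card_pick_le)

lemma sgn_idx_less_card: "finite S \<Longrightarrow> j \<in> S \<Longrightarrow> sgn_idx j S < card S"
  unfolding sgn_idx_def by (intro psubset_card_mono) auto

lemma sgn_idx_mono: "finite S \<Longrightarrow> i \<le> j \<Longrightarrow> sgn_idx i S \<le> sgn_idx j S"
  unfolding sgn_idx_def by (intro card_mono) auto

lemma sgn_idx_Diff:
  assumes "finite S" "j \<in> S"
  shows "sgn_idx i S = sgn_idx i (S - {j}) + (if j < i then 1 else 0)"
proof (cases "j < i")
  case True
  then have "{a \<in> S. a < i} = insert j {a \<in> S - {j}. a < i}"
    using assms by auto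
  then show ?thesis
    using True assms by (simp add: sgn_idx_def)
next
  case False
  then have "{a \<in> S. a < i} = {a \<in> S - {j}. a < i}"
    by auto
  then show ?thesis
    using False by (simp add: sgn_idx_def)
qed

text \<open>
  After removal of \<open>j\<close>, the enumeration of a set skips the position of \<open>j\<close>; this is the index shift
  performed by \<open>mat_delete\<close>.
\<close>

lemma pick_Diff:
  assumes S: "finite S" "j \<in> S" and b: "b < card S - 1"
  shows "pick (S - {j}) b = pick S (insert_index (sgn_idx j S) b)"
proof -
  define c where "c = insert_index (sgn_idx j S) b"
  define x where "x = pick S c"
  have c: "c < card S"
    using b by (auto simp: c_def insert_index_def)
  have x: "x \<in> S" "sgn_idx x S = c"
    using c by (simp_all add: x_def pick_in_set_le sgn_idx_pick)
  have "c \<noteq> sgn_idx j S"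
    by (simp add: c_def insert_index_def)
  then have "x \<noteq> j"
    using x by auto
  have "sgn_idx x (S - {j}) = b"
  proof (cases "b < sgn_idx j S")
    case True
    then have "c < sgn_idx j S"
      by (simp add: c_def insert_index_def)
    then have "\<not> j < x"
      using sgn_idx_mono[OF S(1), of j x] x by auto
    then show ?thesis
      using sgn_idx_Diff[OF S, of x] x True by (simp add: c_def insert_index_def)
  next
    case False
    then have "c > sgn_idx j S"
      by (simp add: c_def insert_index_def)
    then have "j < x"
      using sgn_idx_mono[OF S(1), of x j] x \<open>x \<noteq> j\<close> by force
    then show ?thesis
      using sgn_idx_Diff[OF S, of x] x False by (simp add: c_def insert_index_def)
  qed
  then show ?thesis
    using pick_sgn_idx[of x "S - {j}"] x(1) \<open>x \<noteq> j\<close> by (simp add: x_def c_def)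
qed

lemma sum_pick: "finite S \<Longrightarrow> (\<Sum>b<card S. f b) = (\<Sum>j\<in>S. f (sgn_idx j S))"
  by (rule sum.reindex_bij_witness[of _ "\<lambda>j. sgn_idx j S" "pick S"])
    (auto simp: sgn_idx_pick sgn_idx_less_card pick_in_set_le)

lemma set_minor_laplace:
  assumes I: "finite I" "i \<in> I" and J: "finite J" "card J = card I"
  shows "set_minor u I J = (\<Sum>j\<in>J. (- 1) ^ (sgn_idx i I + sgn_idx j J) * u i j * set_minor u (I - {i}) (J - {j}))"
proof -
  let ?A = "mat (card I) (card I) (\<lambda>(a, b). u (pick I a) (pick J b))"
  let ?i = "sgn_idx i I"
  have i: "?i < card I"
    by (rule sgn_idx_less_card[OF I])
  have del: "mat_delete ?A ?i (sgn_idx j J) =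
      mat (card (I - {i})) (card (I - {i})) (\<lambda>(a, b). u (pick (I - {i}) a) (pick (J - {j}) b))"
    if "j \<in> J" for j
    using I J that
    by (intro eq_matI)
      (auto simp: mat_delete_def pick_Diff insert_index_def)
  have "set_minor u I J = (\<Sum>b<card J. ?A $$ (?i, b) * cofactor ?A ?i b)"
    unfolding set_minor_def J(2) by (rule laplace_expansion_row) (use i in auto)
  also have "\<dots> = (\<Sum>j\<in>J. ?A $$ (?i, sgn_idx j J) * cofactor ?A ?i (sgn_idx j J))"
    by (rule sum_pick[OF J(1)])
  also have "\<dots> = (\<Sum>j\<in>J. (- 1) ^ (sgn_idx i I + sgn_idx j J) * u i j * set_minor u (I - {i}) (J - {j}))"
  proof (rule sum.cong)
    fix j assume j: "j \<in> J"
    then have "sgn_idx j J < card I"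
      using sgn_idx_less_card[OF J(1)] J(2) by simp
    then show "?A $$ (?i, sgn_idx j J) * cofactor ?A ?i (sgn_idx j J) =
        (- 1) ^ (sgn_idx i I + sgn_idx j J) * u i j * set_minor u (I - {i}) (J - {j})"
      using i j I(2) unfolding cofactor_def del[OF j] set_minor_def[of u "I - {i}"] by simp
  qed simp
  finally show ?thesis .
qed

lemma set_minor_cong:
  assumes "card J = card I" "\<And>i j. i \<in> I \<Longrightarrow> j \<in> J \<Longrightarrow> u i j = v i j"
  shows "set_minor u I J = set_minor v I J"
  unfolding set_minor_def using assms
  by (intro arg_cong[where f = det] eq_matI) (auto intro!: assms(2) pick_in_set_le)

lemma set_minor_equal_rows:
  assumes I: "finite I" "i \<in> I" "l \<in> I" "i \<noteq> l" and J: "card J = card I"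
    and eq: "\<And>j. j \<in> J \<Longrightarrow> u i j = u l j"
  shows "set_minor u I J = 0"
  unfolding set_minor_def
proof (rule det_identical_rows)
  show "sgn_idx i I \<noteq> sgn_idx l I"
    using I pick_sgn_idx by metis
  show "sgn_idx i I < card I" "sgn_idx l I < card I"
    using I by (simp_all add: sgn_idx_less_card)
  then show "row (mat (card I) (card I) (\<lambda>(a, b). u (pick I a) (pick J b))) (sgn_idx i I) =
      row (mat (card I) (card I) (\<lambda>(a, b). u (pick I a) (pick J b))) (sgn_idx l I)"
    using I J by (intro eq_vecI) (simp_all add: eq pick_in_set_le)
qed simp

lemma (in comm_ring_hom) hom_set_minor: "hom (set_minor u I J) = set_minor (\<lambda>i j. hom (u i j)) I J"
  unfolding set_minor_def hom_det[symmetric]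
  by (intro arg_cong[where f = det] eq_matI) auto

lemma set_minor_smult: "c ^ card I * set_minor u I J = set_minor (\<lambda>i j. c * u i j) I J"
proof -
  have "c \<cdot>\<^sub>m mat (card I) (card I) (\<lambda>(a, b). u (pick I a) (pick J b)) =
      mat (card I) (card I) (\<lambda>(a, b). c * u (pick I a) (pick J b))"
    by (intro eq_matI) auto
  then show ?thesis
    unfolding set_minor_def by (metis det_smult dim_col_mat(1))
qed

text \<open>
  A matrix that factors through fewer than \<open>card I\<close> indices factors through a square matrix with a zero
  column.
\<close>

lemma set_minor_low_rank:
  fixes T :: "nat set"
  assumes T: "finite T" "card T < card I"
  shows "set_minor (\<lambda>i j. \<Sum>t\<in>T. p i t * q t j) I J = 0"
proof -
  let ?n = "card I"
  \<comment> \<open>both factors are padded with zeros to square matrices, so that their determinants make sense\<close>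
  let ?P = "mat ?n ?n (\<lambda>(a, l). if l < card T then p (pick I a) (pick T l) else 0)"
  let ?Q = "mat ?n ?n (\<lambda>(l, b). if l < card T then q (pick T l) (pick J b) else 0)"
  have sum: "(\<Sum>t\<in>T. p i t * q t j) =
      (\<Sum>l<?n. (if l < card T then p i (pick T l) else 0) * (if l < card T then q (pick T l) j else 0))"
    for i j
  proof -
    have "(\<Sum>t\<in>T. p i t * q t j) = (\<Sum>l<card T. p i (pick T l) * q (pick T l) j)"
      by (simp add: sum_pick[OF T(1)])
    also have "\<dots> = (\<Sum>l<?n. (if l < card T then p i (pick T l) else 0) * (if l < card T then q (pick T l) j else 0))"
      using T(2) by (intro sum.mono_neutral_cong_left) auto
    finally show ?thesis .
  qed
  have "mat ?n ?n (\<lambda>(a, b). \<Sum>t\<in>T. p (pick I a) t * q t (pick J b)) = ?P * ?Q"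
    by (intro eq_matI) (auto simp: scalar_prod_def sum atLeast0LessThan intro!: sum.cong)
  then have "set_minor (\<lambda>i j. \<Sum>t\<in>T. p i t * q t j) I J = det ?P * det ?Q"
    unfolding set_minor_def by (simp add: det_mult[of _ ?n])
  also have "det ?P = (\<Sum>a<?n. ?P $$ (a, card T) * cofactor ?P a (card T))"
    by (rule laplace_expansion_column) (use T in auto)
  also have "\<dots> = 0"
    using T(2) by (intro sum.neutral) auto
  finally show ?thesis by simp
qed

context poly_ideal
begin

lemma set_minor_cong_mem:
  assumes "card J = card I'"
    and "\<And>i j. i \<in> I' \<Longrightarrow> j \<in> J \<Longrightarrow> u i j - v i j \<in> I \<and> vars (u i j) \<subseteq> V \<and> vars (v i j) \<subseteq> V"
  shows "set_minor u I' J - set_minor v I' J \<in> I"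
  unfolding set_minor_def
  by (rule det_cong_mem[OF mat_carrier mat_carrier]) (simp add: assms pick_in_set_le)

text \<open>
  The form in which rank conditions are used: it suffices that a multiple of the matrix factors modulo the
  ideal. The factor \<open>c\<close> enters once for each row.
\<close>

lemma low_rank_mem:
  fixes T :: "nat set"
  assumes T: "finite T" "card T < card I'" and J: "card J = card I'"
    and cong: "\<And>i j. i \<in> I' \<Longrightarrow> j \<in> J \<Longrightarrow> c * u i j - (\<Sum>t\<in>T. p i t * q t j) \<in> I"
    and u: "\<And>i j. i \<in> I' \<Longrightarrow> j \<in> J \<Longrightarrow> vars (u i j) \<subseteq> V" and c: "vars c \<subseteq> V"
    and p: "\<And>i t. i \<in> I' \<Longrightarrow> t \<in> T \<Longrightarrow> vars (p i t) \<subseteq> V"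
    and q: "\<And>t j. t \<in> T \<Longrightarrow> j \<in> J \<Longrightarrow> vars (q t j) \<subseteq> V"
  shows "c ^ card I' * set_minor u I' J \<in> I"
proof -
  have "set_minor (\<lambda>i j. c * u i j) I' J - set_minor (\<lambda>i j. \<Sum>t\<in>T. p i t * q t j) I' J \<in> I"
    using J cong u c p q by (intro set_minor_cong_mem conjI vars_subset_intros) auto
  then show ?thesis
    by (simp add: set_minor_low_rank[OF T] set_minor_smult)
qed

end

lemma vars_set_minor_subset:
  assumes "card J = card I" "\<And>i j. i \<in> I \<Longrightarrow> j \<in> J \<Longrightarrow> vars (u i j) \<subseteq> V"
  shows "vars (set_minor u I J) \<subseteq> V"
proof -
  let ?A = "mat (card I) (card I) (\<lambda>(a, b). u (pick I a) (pick J b))"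
  have "vars (?A $$ (a, p a)) \<subseteq> V" if "p permutes {0..<card I}" "a \<in> {0..<card I}" for p a
    using that assms permutes_in_image[of p "{0..<card I}" a] by (simp add: pick_in_set_le)
  then show ?thesis
    unfolding set_minor_def det_def'[OF mat_carrier]
    by (intro vars_sum_subset vars_mult_subset vars_prod_subset) (auto simp: sign_def)
qed

section \<open>Support forms\<close>

text \<open>
  For \<open>C\<close> regarded as an alternating form with coordinates \<open>C\<^sub>T\<close>, these are the coordinates of the exterior
  product of row \<open>i\<close> of \<open>u\<close> with \<open>C\<close>.
\<close>

definition support_form :: "(nat \<Rightarrow> nat \<Rightarrow> 'b::comm_ring_1) \<Rightarrow> (nat set \<Rightarrow> 'b) \<Rightarrow> nat \<Rightarrow> nat set \<Rightarrow> 'b"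
  where "support_form u C i S = (\<Sum>j\<in>S. (- 1) ^ sgn_idx j S * u i j * C (S - {j}))"

lemma h_supp_eq: "h_supp k m n M = support_form (u_entry k m n M) (\<lambda>T. Var (CV T))"
  by (intro ext) (simp add: h_supp_def support_form_def)

lemma (in comm_ring_hom) hom_support_form: "hom (support_form u C i S) = support_form (\<lambda>i j. hom (u i j)) (\<lambda>T. hom (C T)) i S"
  by (simp add: support_form_def hom_distribs)

text \<open>
  The right-hand side is the Laplace expansion along the added row; the sign is that of its position.
\<close>

lemma support_form_set_minor_border:
  assumes "finite I" "i \<notin> I" "finite S" "card S = Suc (card I)"
  shows "set_minor u (insert i I) S = (- 1) ^ sgn_idx i (insert i I) * support_form u (set_minor u I) i S"
  using assms
  by (subst set_minor_laplace[of _ i]) (auto simp: support_form_def sum_distrib_left power_add mult_ac)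

text \<open>
  Repeating row \<open>i\<close> of the selection gives a determinant with two equal rows, and its Laplace expansion
  along the repeated row is, up to sign, the support form. The repeated row is stored under an index \<open>x\<close> outside \<open>I\<close>.
\<close>

lemma support_form_set_minor_zero:
  assumes I: "finite I" "i \<in> I" and S: "finite S" "card S = Suc (card I)"
  shows "support_form u (set_minor u I) i S = 0"
proof -
  obtain x where x: "x \<notin> I"
    using I(1) ex_new_if_finite infinite_UNIV_nat by blast
  let ?u = "u(x := u i)"
  have "support_form u (set_minor u I) i S = support_form ?u (set_minor ?u I) x S"
    unfolding support_form_def using S x
    by (intro sum.cong arg_cong2[where f = "(*)"] set_minor_cong) auto
  also have "\<dots> = (- 1) ^ sgn_idx x (insert x I) * set_minor ?u (insert x I) S"
    unfolding support_form_set_minor_border[OF I(1) x S] by simp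
  also have "set_minor ?u (insert x I) S = 0"
    using I S x by (intro set_minor_equal_rows[of _ x i]) auto
  finally show ?thesis by simp
qed

lemma pick_eqI: "x \<in> S \<Longrightarrow> sgn_idx x S = n \<Longrightarrow> pick S n = x"
  using pick_sgn_idx by metis

lemma T0_alt: "r \<le> n \<Longrightarrow> T0 n r = (\<lambda>l. n - r + l) ` {1..r}"
  unfolding T0_def by (subst image_add_atLeastAtMost) simp

lemma T0_mem: "r \<le> n \<Longrightarrow> T0 n r \<in> \<P> r n"
  by (auto simp: subsets_of_card_def T0_def)

lemma insert_T0_mem: "r \<le> n \<Longrightarrow> j \<in> {1..n - r} \<Longrightarrow> insert j (T0 n r) \<in> \<P> (r + 1) n"
  by (auto simp: subsets_of_card_def T0_def)

lemma Tij_eq: "l \<in> {1..r} \<Longrightarrow> Tij n r l j = insert j (T0 n r) - {n - r + l}"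
  by (auto simp: Tij_def T0_def)

lemma Diff_mem_subsets_of_card: "S \<in> \<P> (r + 1) n \<Longrightarrow> j \<in> S \<Longrightarrow> S - {j} \<in> \<P> r n"
  by (auto simp: subsets_of_card_def)

lemma Tij_mem:
  assumes "r \<le> n" "l \<in> {1..r}" "j \<in> {1..n - r}"
  shows "Tij n r l j \<in> \<P> r n - {T0 n r}"
proof -
  have "Tij n r l j \<in> \<P> r n"
    unfolding Tij_eq[OF assms(2)] using assms
    by (intro Diff_mem_subsets_of_card insert_T0_mem) (auto simp: T0_def)
  moreover have "j \<in> Tij n r l j" "j \<notin> T0 n r"
    using assms by (auto simp: Tij_def T0_def)
  ultimately show ?thesis
    by auto
qed

text \<open>
  The support form of \<open>T\<^sub>0 \<union> {j}\<close> has the shape of the Kipnis-Shamir polynomial \<open>f\<^sub>i\<^sub>,\<^sub>j\<close>, with \<open>(-1)\<^sup>l C\<close> at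
  \<open>T\<^sub>l\<^sub>,\<^sub>j\<close> in the place of \<open>y\<^sub>l\<^sub>,\<^sub>j\<close>: \<open>j\<close> precedes all of \<open>T\<^sub>0\<close>, so the \<open>l\<close>-th element of \<open>T\<^sub>0\<close> has \<open>l\<close>
  predecessors.
\<close>

lemma support_form_T0:
  assumes r: "r \<le> n" and j: "j \<in> {1..n - r}"
  shows "support_form u C i (insert j (T0 n r)) =
    u i j * C (T0 n r) + (\<Sum>l = 1..r. (- 1) ^ l * u i (n - r + l) * C (Tij n r l j))"
proof -
  let ?S = "insert j (T0 n r)"
  have notin: "j \<notin> T0 n r" and fin: "finite (T0 n r)"
    using j by (auto simp: T0_def)
  have "{a \<in> ?S. a < j} = {}"
    using j by (auto simp: T0_def)
  then have 0: "sgn_idx j ?S = 0"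
    by (simp add: sgn_idx_def)
  have l: "sgn_idx (n - r + l) ?S = l" if "l \<in> {1..r}" for l
  proof -
    have "{a \<in> ?S. a < n - r + l} = insert j {n - r + 1..<n - r + l}"
      using j that by (auto simp: T0_def)
    then show ?thesis
      using j that by (simp add: sgn_idx_def)
  qed
  have "support_form u C i ?S = u i j * C (T0 n r) +
      (\<Sum>s\<in>T0 n r. (- 1) ^ sgn_idx s ?S * u i s * C (?S - {s}))"
    unfolding support_form_def using notin fin by (simp add: 0)
  also have "(\<Sum>s\<in>T0 n r. (- 1) ^ sgn_idx s ?S * u i s * C (?S - {s})) =
      (\<Sum>l = 1..r. (- 1) ^ sgn_idx (n - r + l) ?S * u i (n - r + l) * C (?S - {n - r + l}))"
    unfolding T0_alt[OF r] by (subst sum.reindex) (auto simp: inj_on_def)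
  also have "\<dots> = (\<Sum>l = 1..r. (- 1) ^ l * u i (n - r + l) * C (Tij n r l j))"
    by (intro sum.cong) (simp_all add: l Tij_eq)
  finally show ?thesis .
qed

context poly_ideal
begin

text \<open>
  Solving the support form of \<open>T \<union> {j}\<close> for the term with \<open>C\<^sub>T\<close> writes \<open>C\<^sub>T u\<^sub>i\<^sub>,\<^sub>j\<close> through the entries of row
  \<open>i\<close> in the columns \<open>T\<close>. The coefficients do not depend on \<open>i\<close>, which makes this a matrix factorisation;
  for \<open>j \<in> T\<close> they form \<open>C\<^sub>T\<close> times an identity matrix.
\<close>

lemma support_form_cong_mem:
  assumes T: "finite T"
    and rel: "j \<notin> T \<Longrightarrow> support_form u C i (insert j T) \<in> I"
  shows "C T * u i j - (\<Sum>t\<in>T. u i t *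
      (if j \<in> T then if t = j then C T else 0
       else - ((- 1) ^ (sgn_idx j (insert j T) + sgn_idx t (insert j T)) * C (insert j T - {t})))) \<in> I"
proof (cases "j \<in> T")
  case True
  have "(\<Sum>t\<in>T. u i t * (if t = j then C T else 0)) = u i j * C T"
    using T True by (simp add: if_distrib[of "\<lambda>x. u i _ * x"] sum.delta cong: if_cong)
  then show ?thesis
    using True by (simp add: zero_mem mult.commute)
next
  case False
  let ?S = "insert j T"
  have "support_form u C i ?S = (- 1) ^ sgn_idx j ?S * u i j * C T +
      (\<Sum>t\<in>T. (- 1) ^ sgn_idx t ?S * u i t * C (?S - {t}))"
    unfolding support_form_def using False T by simp
  then have "(- 1) ^ sgn_idx j ?S * support_form u C i ?S = C T * u i j +
      (- 1) ^ sgn_idx j ?S * (\<Sum>t\<in>T. (- 1) ^ sgn_idx t ?S * u i t * C (?S - {t}))"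
    by (simp add: distrib_left mult.assoc mult.commute[of "u i j"])
  also have "(- 1) ^ sgn_idx j ?S * (\<Sum>t\<in>T. (- 1) ^ sgn_idx t ?S * u i t * C (?S - {t})) =
      - (\<Sum>t\<in>T. u i t * - ((- 1) ^ (sgn_idx j ?S + sgn_idx t ?S) * C (?S - {t})))"
    unfolding sum_distrib_left sum_negf[symmetric]
    by (intro sum.cong refl) (simp add: power_add mult_ac)
  finally have "(- 1) ^ sgn_idx j ?S * support_form u C i ?S = C T * u i j -
      (\<Sum>t\<in>T. u i t * - ((- 1) ^ (sgn_idx j ?S + sgn_idx t ?S) * C (?S - {t})))"
    by (simp only: diff_conv_add_uminus)
  then show ?thesis
    using rel[OF False] False sign_mult_mem_iff[of "sgn_idx j ?S" "support_form u C i ?S"] by simp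
qed

end

section \<open>The ideals of the three modelings\<close>

definition KS_vars :: "nat \<Rightarrow> nat \<Rightarrow> nat \<Rightarrow> var set"
  where "KS_vars k n r = XV ` {1..k} \<union> {YV i j |i j. i \<in> {1..r} \<and> j \<in> {1..n - r}}"

definition tilde_vars :: "nat \<Rightarrow> nat \<Rightarrow> nat \<Rightarrow> var set"
  where "tilde_vars k n r =
    XV ` {1..k} \<union> {CV (Tij n r i j) |i j. i \<in> {1..r} \<and> j \<in> {1..n - r}}"

lemma R_KS_eq: "R_KS k n r = PolyR (KS_vars k n r)"
  and R_supp_tilde_eq: "R_supp_tilde k n r = PolyR (tilde_vars k n r)"
  by (simp_all add: R_KS_def R_supp_tilde_def KS_vars_def tilde_vars_def)

lemma KS_vars_cases [consumes 1, case_names X Y]: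
  assumes "v \<in> KS_vars k n r"
  obtains i where "v = XV i" "i \<in> {1..k}" | i j where "v = YV i j" "i \<in> {1..r}" "j \<in> {1..n - r}"
  using assms unfolding KS_vars_def by blast

lemma tilde_vars_cases [consumes 1, case_names X C]:
  assumes "v \<in> tilde_vars k n r"
  obtains i where "v = XV i" "i \<in> {1..k}"
    | i j where "v = CV (Tij n r i j)" "i \<in> {1..r}" "j \<in> {1..n - r}"
  using assms unfolding tilde_vars_def by blast

lemma base_subset_KS_vars: "XV ` {1..k} \<subseteq> KS_vars k n r"
  and YV_mem_KS_vars: "i \<in> {1..r} \<Longrightarrow> j \<in> {1..n - r} \<Longrightarrow> YV i j \<in> KS_vars k n r"
  and base_subset_tilde_vars: "XV ` {1..k} \<subseteq> tilde_vars k n r"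
  and Tij_mem_tilde_vars:
    "i \<in> {1..r} \<Longrightarrow> j \<in> {1..n - r} \<Longrightarrow> CV (Tij n r i j) \<in> tilde_vars k n r"
  unfolding KS_vars_def tilde_vars_def by blast+

lemma minor_eq_set_minor:
  assumes I: "I \<in> \<P> s m" and J: "J \<in> \<P> s n"
  shows "minor k m n M I J = set_minor (u_entry k m n M) I J"
proof -
  have card: "card {i. i < d \<and> Suc i \<in> S} = card S" and
    pick: "b < card S \<Longrightarrow> pick {a. Suc a \<in> S} b = pick S b - 1" if "S \<in> \<P> s d" for S d b
  proof -
    from that have S: "S \<subseteq> {1..d}" "finite S"
      by (auto simp: subsets_of_card_def intro: finite_subset)
    have img: "Suc ` {i. i < d \<and> Suc i \<in> S} = S"
    proof (intro equalityI subsetI)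
      fix x assume "x \<in> S"
      then show "x \<in> Suc ` {i. i < d \<and> Suc i \<in> S}"
        using S by (cases x) force+
    qed auto
    have "card (Suc ` {i. i < d \<and> Suc i \<in> S}) = card {i. i < d \<and> Suc i \<in> S}"
      by (rule card_image) simp
    then show "card {i. i < d \<and> Suc i \<in> S} = card S"
      unfolding img by simp
    show "pick {a. Suc a \<in> S} b = pick S b - 1" if b: "b < card S"
    proof (rule pick_eqI)
      let ?x = "pick S b"
      have x: "?x \<in> S" "?x \<ge> 1"
        using pick_in_set_le[OF b] S by auto
      then show "?x - 1 \<in> {a. Suc a \<in> S}"
        by simp
      have img: "Suc ` {i \<in> {a. Suc a \<in> S}. i < ?x - 1} = {i \<in> S. i < ?x}"
      proof (intro equalityI subsetI)
        fix y assume "y \<in> {i \<in> S. i < ?x}"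
        then show "y \<in> Suc ` {i \<in> {a. Suc a \<in> S}. i < ?x - 1}"
          using S by (cases y) force+
      qed auto
      have "card {i \<in> {a. Suc a \<in> S}. i < ?x - 1} = card {i \<in> S. i < ?x}"
        unfolding img[symmetric] by (rule card_image[symmetric]) simp
      then show "sgn_idx (?x - 1) {a. Suc a \<in> S} = b"
        using sgn_idx_pick[OF b] by (simp add: sgn_idx_def)
    qed
  qed
  have "card I = s" "card J = s"
    using I J by (simp_all add: subsets_of_card_def)
  then show ?thesis
    unfolding minor_def set_minor_def submatrix_def u_entry_def
    using card[OF I] card[OF J] pick[OF I] pick[OF J]
    by (intro arg_cong[where f = det] eq_matI) (simp_all add: Mx_def)
qed

lemma u_entry_eq:
  assumes "i \<in> {1..m}" "j \<in> {1..n}"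
  shows "u_entry k m n M i j = (\<Sum>l = 1..k. Var (XV l) * Const (M l $$ (i - 1, j - 1)))"
  using assms by (auto simp: u_entry_def Mx_def)

lemma vars_u_entry:
  assumes "i \<in> {1..m}" "j \<in> {1..n}" "XV ` {1..k} \<subseteq> V"
  shows "vars (u_entry k m n M i j) \<subseteq> V"
  unfolding u_entry_eq[OF assms(1,2)] using assms(3)
  by (intro vars_sum_subset vars_mult_subset) auto

lemma vars_set_minor_u_entry:
  assumes "I \<in> \<P> s m" "J \<in> \<P> s n" "XV ` {1..k} \<subseteq> V"
  shows "vars (set_minor (u_entry k m n M) I J) \<subseteq> V"
  using assms by (intro vars_set_minor_subset vars_u_entry) (auto simp: subsets_of_card_def)

lemma vars_minor:
  assumes "I \<in> \<P> s m" "J \<in> \<P> s n" "XV ` {1..k} \<subseteq> V"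
  shows "vars (minor k m n M I J) \<subseteq> V"
  using vars_set_minor_u_entry[OF assms] by (simp add: minor_eq_set_minor[OF assms(1,2)])

lemma vars_f_KS:
  assumes "r \<le> n" "i \<in> {1..m}" "j \<in> {1..n - r}"
  shows "vars (f_KS k m n r M i j) \<subseteq> KS_vars k n r"
  unfolding f_KS_def using assms
  by (intro vars_add_subset vars_sum_subset vars_mult_subset vars_u_entry)
    (auto intro: YV_mem_KS_vars simp: base_subset_KS_vars simp del: One_nat_def)

lemma vars_support_form:
  assumes "i \<in> {1..m}" "S \<subseteq> {1..n}" "XV ` {1..k} \<subseteq> V" "\<And>j. j \<in> S \<Longrightarrow> vars (C (S - {j})) \<subseteq> V"
  shows "vars (support_form (u_entry k m n M) C i S) \<subseteq> V"
  unfolding support_form_def using assms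
  by (intro vars_sum_subset vars_mult_subset vars_power_subset vars_u_entry) auto

lemma vars_h_supp:
  assumes "i \<in> {1..m}" "S \<in> \<P> (r + 1) n"
  shows "vars (h_supp k m n M i S) \<subseteq> XV ` {1..k} \<union> CV ` \<P> r n"
  unfolding h_supp_eq using assms Diff_mem_subsets_of_card[OF assms(2)]
  by (intro vars_support_form) (auto simp: subsets_of_card_def)

lemma poly_ideal_minors: "poly_ideal (XV ` {1..k}) (I_minors k m n r M)"
  unfolding I_minors_def R_base_def by (rule poly_ideal_genideal) (elim CollectE exE conjE, simp only: vars_minor subset_refl)

lemma poly_ideal_KS:
  "r \<le> n \<Longrightarrow> poly_ideal (KS_vars k n r) (I_KS k m n r M)"
  unfolding I_KS_def R_KS_eq by (rule poly_ideal_genideal) (elim CollectE exE conjE, simp only: vars_f_KS)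

lemma poly_ideal_suppGb:
  "poly_ideal (XV ` {1..k} \<union> CV ` \<P> r n) (I_suppGb k m n r M)"
  unfolding I_suppGb_def R_suppGb_def by (rule poly_ideal_genideal) (elim CollectE exE conjE, simp only: vars_h_supp)

lemma I_minors_induct [consumes 1, case_names zero minor add mult]:
  assumes "p \<in> I_minors k m n r M" "P 0"
    and "\<And>I J. I \<in> \<P> (r + 1) m \<Longrightarrow> J \<in> \<P> (r + 1) n \<Longrightarrow> P (set_minor (u_entry k m n M) I J)"
    and "\<And>p q. P p \<Longrightarrow> P q \<Longrightarrow> P (p + q)"
    and "\<And>a p. vars a \<subseteq> XV ` {1..k} \<Longrightarrow> P p \<Longrightarrow> P (a * p)"
  shows "P p"
  using assms(1) unfolding I_minors_def R_base_def
proof (induction rule: genideal_induct)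
  case (vars g)
  then show ?case by (elim CollectE exE conjE) (simp only: vars_minor subset_refl)
next
  case (gen g)
  then show ?case by (elim CollectE exE conjE) (simp only: minor_eq_set_minor assms(3))
qed (rule assms; assumption)+

lemma set_minor_mem_I_minors:
  assumes "I \<in> \<P> (r + 1) m" "J \<in> \<P> (r + 1) n"
  shows "set_minor (u_entry k m n M) I J \<in> I_minors k m n r M"
  unfolding I_minors_def R_base_def minor_eq_set_minor[OF assms, symmetric]
  by (rule genideal_mem, elim CollectE exE conjE, simp only: vars_minor subset_refl)
    (use assms in blast)

lemma I_KS_induct [consumes 2, case_names zero gen add mult]:
  assumes "p \<in> I_KS k m n r M" "r \<le> n" "P 0"
    and "\<And>i j. i \<in> {1..m} \<Longrightarrow> j \<in> {1..n - r} \<Longrightarrow> P (f_KS k m n r M i j)"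
    and "\<And>p q. P p \<Longrightarrow> P q \<Longrightarrow> P (p + q)"
    and "\<And>a p. vars a \<subseteq> KS_vars k n r \<Longrightarrow>
      P p \<Longrightarrow> P (a * p)"
  shows "P p"
  using assms(1) unfolding I_KS_def R_KS_eq
proof (induction rule: genideal_induct)
  case (vars g)
  then show ?case by (elim CollectE exE conjE) (simp only: vars_f_KS assms(2))
next
  case (gen g)
  then show ?case by (elim CollectE exE conjE) (simp only: assms(4))
qed (rule assms; assumption)+

lemma f_KS_mem:
  assumes "r \<le> n" "i \<in> {1..m}" "j \<in> {1..n - r}"
  shows "f_KS k m n r M i j \<in> I_KS k m n r M"
  unfolding I_KS_def R_KS_eq
  by (rule genideal_mem, elim CollectE exE conjE, simp only: vars_f_KS assms(1))
    (use assms in blast)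

lemma I_suppGb_induct [consumes 1, case_names zero gen add mult]:
  assumes "p \<in> I_suppGb k m n r M" "P 0"
    and "\<And>i S. i \<in> {1..m} \<Longrightarrow> S \<in> \<P> (r + 1) n \<Longrightarrow> P (support_form (u_entry k m n M) (\<lambda>T. Var (CV T)) i S)"
    and "\<And>p q. P p \<Longrightarrow> P q \<Longrightarrow> P (p + q)"
    and "\<And>a p. vars a \<subseteq> XV ` {1..k} \<union> CV ` \<P> r n \<Longrightarrow> P p \<Longrightarrow> P (a * p)"
  shows "P p"
  using assms(1) unfolding I_suppGb_def R_suppGb_def h_supp_eq
proof (induction rule: genideal_induct)
  case (vars g)
  then show ?case by (elim CollectE exE conjE) (simp only: vars_h_supp[unfolded h_supp_eq])
next
  case (gen g)
  then show ?case by (elim CollectE exE conjE) (simp only: assms(3))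
qed (rule assms; assumption)+

lemma support_form_mem_I_suppGb:
  assumes "i \<in> {1..m}" "S \<in> \<P> (r + 1) n"
  shows "support_form (u_entry k m n M) (\<lambda>T. Var (CV T)) i S \<in> I_suppGb k m n r M"
  unfolding I_suppGb_def R_suppGb_def h_supp_eq[symmetric]
  by (rule genideal_mem, elim CollectE exE conjE, simp only: vars_h_supp)
    (use assms in blast)

text \<open>
  Modulo the support relations, \<open>C\<^sub>T u\<close> factors through the \<open>r\<close> columns \<open>T\<close> of \<open>u\<close>.
\<close>

lemma power_mult_I_minors_mem:
  assumes T: "T \<in> \<P> r n" and f: "f \<in> I_minors k m n r M"
  shows "Var (CV T) ^ (r + 1) * f \<in> I_suppGb k m n r M"
  using f
proof (induction rule: I_minors_induct)
  interpret Gb: poly_ideal "XV ` {1..k} \<union> CV ` \<P> r n" "I_suppGb k m n r M"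
    by (rule poly_ideal_suppGb)
  {
    case zero
    show ?case by (simp add: Gb.zero_mem)
  next
    case (minor I J)
    let ?V = "XV ` {1..k} \<union> CV ` \<P> r n" and ?u = "u_entry k m n M"
    have fin: "finite T" and card: "card T = r" "card I = r + 1" "card J = r + 1"
      and sub: "T \<subseteq> {1..n}" "I \<subseteq> {1..m}" "J \<subseteq> {1..n}"
      using T minor by (auto simp: subsets_of_card_def intro: finite_subset)
    have ins: "insert j T \<in> \<P> (r + 1) n" if "j \<in> J" "j \<notin> T" for j
      using that sub card fin by (auto simp: subsets_of_card_def)
    have vars_C: "vars (Var (CV (insert j T - {t})) :: 'a mpoly) \<subseteq> ?V" if "j \<in> J" "j \<notin> T" "t \<in> T" for j t
      using Diff_mem_subsets_of_card[OF ins[OF that(1,2)], of t] that by auto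
    have "Var (CV T) ^ card I * set_minor ?u I J \<in> I_suppGb k m n r M"
    proof (rule Gb.low_rank_mem[OF fin, of _ _ _ _ ?u])
      fix i j assume ij: "i \<in> I" "j \<in> J"
      have "Var (CV T) * ?u i j - (\<Sum>t\<in>T. ?u i t *
          (if j \<in> T then if t = j then Var (CV T) else 0
           else - ((- 1) ^ (sgn_idx j (insert j T) + sgn_idx t (insert j T)) *
             Var (CV (insert j T - {t}))))) \<in> I_suppGb k m n r M"
        by (rule Gb.support_form_cong_mem[OF fin, where C = "\<lambda>T. Var (CV T)"])
          (use ij sub ins in \<open>auto intro!: support_form_mem_I_suppGb\<close>)
      then show "Var (CV T) * ?u i j - (\<Sum>t\<in>T. ?u i t * (\<lambda>t j.
          (if j \<in> T then if t = j then Var (CV T) else 0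
           else - ((- 1) ^ (sgn_idx j (insert j T) + sgn_idx t (insert j T)) *
             Var (CV (insert j T - {t}))))) t j) \<in> I_suppGb k m n r M"
        by simp
    next
      fix t j assume tj: "t \<in> T" "j \<in> J"
      have "vars (- ((- 1) ^ (sgn_idx j (insert j T) + sgn_idx t (insert j T)) *
             Var (CV (insert j T - {t}))) :: 'a mpoly) \<subseteq> ?V" if "j \<notin> T"
        unfolding vars_uminus
        by (intro vars_mult_subset vars_power_subset vars_C tj that) simp
      then show "vars (if j \<in> T then if t = j then Var (CV T) else 0
           else - ((- 1) ^ (sgn_idx j (insert j T) + sgn_idx t (insert j T)) *
             Var (CV (insert j T - {t}))) :: 'a mpoly) \<subseteq> ?V"
        using T by simp
    next
      have u: "vars (?u i j) \<subseteq> ?V" if "i \<in> I" "j \<in> {1..n}" for i j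
        by (rule vars_u_entry) (use that sub in auto)
      show "vars (?u i j) \<subseteq> ?V" if "i \<in> I" "j \<in> J" for i j
        by (rule u) (use that sub in auto)
      show "vars (?u i t) \<subseteq> ?V" if "i \<in> I" "t \<in> T" for i t
        by (rule u) (use that sub in auto)
    qed (use card T in auto)
    then show ?case
      using card by simp
  next
    case (add p q)
    then show ?case by (simp add: distrib_left Gb.add_mem)
  next
    case (mult a p)
    have "a * (Var (CV T) ^ (r + 1) * p) \<in> I_suppGb k m n r M"
      using mult by - (rule Gb.mult_mem, blast+)
    then show ?case by (simp only: mult.left_commute)
  }
qed

section \<open>Support minors and Kipnis--Shamir\<close>

(* With 1 kept as a literal, index ranges such as {1..r} stay in the form in which they are stated. *)
declare One_nat_def [simp del]

text \<open>
  The matrix \<open>Q = (-Y | 1)\<close>, with rows \<open>1..r\<close>: the Kipnis-Shamir equations say that \<open>u\<close> equals its last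
  \<open>r\<close> columns times \<open>Q\<close>.
\<close>

definition KS_mat :: "nat \<Rightarrow> nat \<Rightarrow> nat \<Rightarrow> nat \<Rightarrow> 'a::comm_ring_1 mpoly"
  where "KS_mat n r l j =
    (if j \<le> n - r then - Var (YV l j) else if j = n - r + l then 1 else 0)"

lemma KS_mat_left: "j \<le> n - r \<Longrightarrow> KS_mat n r l j = - Var (YV l j)"
  and KS_mat_right: "s \<ge> 1 \<Longrightarrow> KS_mat n r l (n - r + s) = (if s = l then 1 else 0)"
  by (simp_all add: KS_mat_def)

lemma set_minor_KS_mat_T0:
  assumes r: "r \<le> n"
  shows "set_minor (KS_mat n r) {1..r} (T0 n r) = 1"
proof -
  have 1: "pick {1..r} a = a + 1" if "a < r" for a
  proof (rule pick_eqI)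
    have "{i \<in> {1..r}. i < a + 1} = {1..a}"
      using that by auto
    then show "sgn_idx (a + 1) {1..r} = a"
      by (simp add: sgn_idx_def)
  qed (use that in auto)
  have 2: "pick (T0 n r) b = n - r + (b + 1)" if "b < r" for b
  proof (rule pick_eqI)
    have "{i \<in> T0 n r. i < n - r + (b + 1)} = {n - r + 1..<n - r + (b + 1)}"
      using that r by (auto simp: T0_def)
    then show "sgn_idx (n - r + (b + 1)) (T0 n r) = b"
      by (simp add: sgn_idx_def)
  qed (use that r in \<open>auto simp: T0_def\<close>)
  have "mat (card {1..r}) (card {1..r}) (\<lambda>(a, b). KS_mat n r (pick {1..r} a) (pick (T0 n r) b)) =
      (1\<^sub>m r :: 'a mpoly mat)"
    by (intro eq_matI) (simp_all add: 1 2 KS_mat_right)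
  then show ?thesis
    by (simp add: set_minor_def)
qed

text \<open>
  The relation of \<open>T\<^sub>0 \<union> {j}\<close> for row \<open>l\<close> of \<open>Q\<close> itself reads \<open>-y\<^sub>l\<^sub>,\<^sub>j + (-1)\<^sup>l C = 0\<close> with \<open>C\<close> the minor
  at \<open>T\<^sub>l\<^sub>,\<^sub>j\<close>, because the last \<open>r\<close> columns of \<open>Q\<close> form an identity matrix.
\<close>

lemma set_minor_KS_mat_Tij:
  assumes r: "r \<le> n" and l: "l \<in> {1..r}" and j: "j \<in> {1..n - r}"
  shows "set_minor (KS_mat n r) {1..r} (Tij n r l j) = (- 1) ^ l * Var (YV l j)"
proof -
  let ?Q = "KS_mat n r :: nat \<Rightarrow> nat \<Rightarrow> 'a mpoly"
  let ?C = "set_minor ?Q {1..r}"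
  have S: "finite (insert j (T0 n r))" "card (insert j (T0 n r)) = Suc (card {1..r})"
    using insert_T0_mem[OF r j] by (auto simp: subsets_of_card_def intro: finite_subset)
  have "0 = support_form ?Q ?C l (insert j (T0 n r))"
    using support_form_set_minor_zero[OF _ l S, of ?Q] by simp
  also have "\<dots> = ?Q l j * ?C (T0 n r) + (\<Sum>s = 1..r. (- 1) ^ s * ?Q l (n - r + s) * ?C (Tij n r s j))"
    by (rule support_form_T0[OF r j])
  also have "(\<Sum>s = 1..r. (- 1) ^ s * ?Q l (n - r + s) * ?C (Tij n r s j)) =
      (\<Sum>s = 1..r. if s = l then (- 1) ^ s * ?C (Tij n r s j) else 0)"
    by (intro sum.cong) (simp_all add: KS_mat_right)
  also have "\<dots> = (- 1) ^ l * ?C (Tij n r l j)"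
    using l by simp
  finally have "(- 1) ^ l * ?C (Tij n r l j) = Var (YV l j)"
    using j by (simp add: KS_mat_left set_minor_KS_mat_T0[OF r])
  then show ?thesis
    by (metis left_minus_one_mult_self)
qed

text \<open>
  This extends \<open>\<Phi>\<close> from the variables at the \<open>T\<^sub>i\<^sub>,\<^sub>j\<close> to all \<open>C\<^sub>T\<close>.
\<close>

definition KS_subst :: "nat \<Rightarrow> nat \<Rightarrow> var \<Rightarrow> 'a::comm_ring_1 mpoly"
  where "KS_subst n r v = (case v of CV T \<Rightarrow> set_minor (KS_mat n r) {1..r} T | _ \<Rightarrow> Var v)"

lemma psubst_u_entry:
  assumes "i \<in> {1..m}" "j \<in> {1..n}" "\<And>l. l \<in> {1..k} \<Longrightarrow> \<sigma> (XV l) = Var (XV l)"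
  shows "psubst \<sigma> (u_entry k m n M i j) = u_entry k m n M i j"
  by (rule psubst_fix) (use assms vars_u_entry[OF assms(1,2) subset_refl] in blast)

lemma psubst_support_form:
  assumes "i \<in> {1..m}" "S \<subseteq> {1..n}" "\<And>l. l \<in> {1..k} \<Longrightarrow> \<sigma> (XV l) = Var (XV l)"
  shows "psubst \<sigma> (support_form (u_entry k m n M) C i S) = support_form (u_entry k m n M) (\<lambda>T. psubst \<sigma> (C T)) i S"
proof -
  interpret s: comm_ring_hom "psubst \<sigma>" by (rule comm_ring_hom_psubst)
  have "psubst \<sigma> (u_entry k m n M i j) = u_entry k m n M i j" if "j \<in> S" for j
    using that assms by (intro psubst_u_entry) auto
  then show ?thesis
    unfolding s.hom_support_form unfolding support_form_def by (intro sum.cong) simp_all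
qed

lemma vars_KS_subst:
  assumes "v \<in> XV ` {1..k} \<union> CV ` \<P> r n"
  shows "vars (KS_subst n r v :: 'a::comm_ring_1 mpoly) \<subseteq>
    KS_vars k n r"
proof (cases v)
  case (CV T)
  then have T: "T \<in> \<P> r n"
    using assms by auto
  have "vars (KS_mat n r i j :: 'a mpoly) \<subseteq> KS_vars k n r"
    if "i \<in> {1..r}" "j \<in> T" for i j
    using that T YV_mem_KS_vars[of i r j n k] by (auto simp: KS_mat_def subsets_of_card_def)
  then have "vars (set_minor (KS_mat n r) {1..r} T :: 'a mpoly) \<subseteq> KS_vars k n r"
    using T by (intro vars_set_minor_subset) (simp_all add: subsets_of_card_def)
  then show ?thesis
    by (simp add: KS_subst_def CV)
next
  case (XV i)
  then have "v \<in> XV ` {1..k}"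
    using assms by auto
  then show ?thesis
    using base_subset_KS_vars[of k n r] by (auto simp: KS_subst_def XV)
qed (use assms in auto)

text \<open>
  Modulo \<open>I\<^sub>K\<^sub>S\<close>, row \<open>i\<close> of \<open>u\<close> is a combination of the rows of \<open>Q\<close>, and the support form of each row of
  \<open>Q\<close> with the minors of \<open>Q\<close> vanishes.
\<close>

lemma KS_subst_I_suppGb:
  assumes r: "r \<le> n" and p: "p \<in> I_suppGb k m n r M"
  shows "psubst (KS_subst n r) p \<in> I_KS k m n r M"
  using p
proof (induction rule: I_suppGb_induct)
  interpret s: comm_ring_hom "psubst (KS_subst n r) :: 'a mpoly \<Rightarrow> _" by (rule comm_ring_hom_psubst)
  let ?V = "KS_vars k n r"
  interpret KS: poly_ideal ?V "I_KS k m n r M"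
    by (rule poly_ideal_KS[OF r])
  {
    case zero
    show ?case by (simp add: KS.zero_mem)
  next
    case (gen i S)
    let ?u = "u_entry k m n M" and ?Q = "KS_mat n r :: nat \<Rightarrow> nat \<Rightarrow> 'a mpoly"
    let ?C = "set_minor ?Q {1..r}"
    have S: "S \<subseteq> {1..n}" "finite S" "card S = Suc (card {1..r})"
      using gen(2) by (auto simp: subsets_of_card_def intro: finite_subset)
    have cong: "?u i j - (\<Sum>l = 1..r. ?u i (n - r + l) * ?Q l j) \<in> I_KS k m n r M"
      if "j \<in> {1..n}" for j
    proof (cases "j \<le> n - r")
      case True
      then have "?u i j - (\<Sum>l = 1..r. ?u i (n - r + l) * ?Q l j) = f_KS k m n r M i j"
        by (simp add: f_KS_def KS_mat_left sum_negf)
      then show ?thesis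
        using True that gen(1) by (simp add: f_KS_mem[OF r])
    next
      case False
      then have mem: "j - (n - r) \<in> {1..r}"
        using that r by auto
      have "(\<Sum>l = 1..r. ?u i (n - r + l) * ?Q l j) = (\<Sum>l = 1..r. if l = j - (n - r) then ?u i j else 0)"
        using False r by (intro sum.cong) (auto simp: KS_mat_def)
      also have "\<dots> = ?u i j"
        by (simp only: sum.delta[OF finite_atLeastAtMost] mem if_True)
      finally show ?thesis
        by (simp add: KS.zero_mem)
    qed
    have "support_form ?u ?C i S - (\<Sum>j\<in>S. (- 1) ^ sgn_idx j S * (\<Sum>l = 1..r. ?u i (n - r + l) * ?Q l j) * ?C (S - {j})) =
        (\<Sum>j\<in>S. (- 1) ^ sgn_idx j S * (?u i j - (\<Sum>l = 1..r. ?u i (n - r + l) * ?Q l j)) * ?C (S - {j}))"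
      by (simp add: support_form_def sum_subtractf algebra_simps)
    also have "\<dots> \<in> I_KS k m n r M"
    proof (rule KS.sum_mem)
      fix j assume j: "j \<in> S"
      then have "CV (S - {j}) \<in> XV ` {1..k} \<union> CV ` \<P> r n"
        using Diff_mem_subsets_of_card[OF gen(2)] by auto
      then have C: "vars (?C (S - {j})) \<subseteq> KS_vars k n r"
        using vars_KS_subst[of "CV (S - {j})" k r n] by (simp add: KS_subst_def)
      show "(- 1) ^ sgn_idx j S * (?u i j - (\<Sum>l = 1..r. ?u i (n - r + l) * ?Q l j)) * ?C (S - {j})
          \<in> I_KS k m n r M"
        using j S unfolding mult.assoc KS.sign_mult_mem_iff by (intro KS.mult_mem_right[OF C] cong) auto
    qed
    also have "(\<Sum>j\<in>S. (- 1) ^ sgn_idx j S * (\<Sum>l = 1..r. ?u i (n - r + l) * ?Q l j) * ?C (S - {j})) =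
        (\<Sum>l = 1..r. ?u i (n - r + l) * support_form ?Q ?C l S)"
      unfolding support_form_def sum_distrib_left sum_distrib_right
      by (subst sum.swap) (simp add: mult_ac)
    also have "\<dots> = 0"
      using support_form_set_minor_zero[OF finite_atLeastAtMost _ S(2,3), of _ ?Q] by (intro sum.neutral) simp
    finally show ?case
      using gen S by (simp add: psubst_support_form KS_subst_def psubst_Var)
  next
    case (add p q)
    then show ?case by (simp add: s.hom_add KS.add_mem)
  next
    case (mult a p)
    then show ?case
      unfolding s.hom_mult using vars_KS_subst by (intro KS.mult_mem vars_psubst) blast+
  }
qed

text \<open>
  Apply the substitution to \<open>C\<^sup>r\<^sup>+\<^sup>1 f\<close> for \<open>C\<close> at \<open>T\<^sub>0\<close>: it fixes \<open>f\<close> and sends \<open>C\<close> to \<open>1\<close>.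
\<close>

lemma I_minors_subset_I_KS:
  assumes r: "r \<le> n"
  shows "I_minors k m n r M \<subseteq> I_KS k m n r M"
proof
  fix f assume f: "f \<in> I_minors k m n r M"
  interpret s: comm_ring_hom "psubst (KS_subst n r) :: 'a mpoly \<Rightarrow> _" by (rule comm_ring_hom_psubst)
  have "psubst (KS_subst n r) f = f"
    using poly_ideal.vars_mem[OF poly_ideal_minors f] by (intro psubst_fix) (auto simp: KS_subst_def)
  moreover have "psubst (KS_subst n r) (Var (CV (T0 n r))) = (1 :: 'a mpoly)"
    by (simp add: psubst_Var KS_subst_def set_minor_KS_mat_T0[OF r])
  ultimately have "psubst (KS_subst n r) (Var (CV (T0 n r)) ^ (r + 1) * f) = f"
    by (simp add: s.hom_mult s.hom_power)
  then show "f \<in> I_KS k m n r M"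
    using KS_subst_I_suppGb[OF r power_mult_I_minors_mem[OF T0_mem[OF r] f]] by simp
qed

text \<open>
  The inverse of the substitution on the subring on which \<open>\<Phi>\<close> is defined.
\<close>

definition supp_subst :: "nat \<Rightarrow> nat \<Rightarrow> var \<Rightarrow> 'a::comm_ring_1 mpoly"
  where "supp_subst n r v = (case v of YV i j \<Rightarrow> (- 1) ^ i * Var (CV (Tij n r i j)) | _ \<Rightarrow> Var v)"

lemma KS_subst_Tij:
  "r \<le> n \<Longrightarrow> i \<in> {1..r} \<Longrightarrow> j \<in> {1..n - r} \<Longrightarrow>
    KS_subst n r (CV (Tij n r i j)) = (- 1) ^ i * Var (YV i j)"
  by (simp add: KS_subst_def set_minor_KS_mat_Tij)

lemma tilde_vars_subset: "r \<le> n \<Longrightarrow> tilde_vars k n r \<subseteq> XV ` {1..k} \<union> CV ` (\<P> r n - {T0 n r})"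
proof
  fix v assume "r \<le> n" "v \<in> tilde_vars k n r"
  from this(2) show "v \<in> XV ` {1..k} \<union> CV ` (\<P> r n - {T0 n r})"
  proof (cases rule: tilde_vars_cases)
    case (C i j)
    then show ?thesis
      using Tij_mem[OF \<open>r \<le> n\<close> C(2,3)] by (intro UnI2) (simp only: imageI)
  qed simp
qed

lemma psubst_sign_Var: "psubst \<sigma> ((- 1) ^ i * Var v) = (- 1) ^ i * \<sigma> v"
proof -
  interpret s: comm_ring_hom "psubst \<sigma>" by (rule comm_ring_hom_psubst)
  show ?thesis
    by (simp add: s.hom_mult s.hom_power s.hom_uminus psubst_Var)
qed

lemma KS_supp_subst:
  assumes r: "r \<le> n" and p: "vars p \<subseteq> KS_vars k n r"
  shows "psubst (KS_subst n r) (psubst (supp_subst n r) p) = p"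
  unfolding psubst_psubst
proof (rule psubst_fix)
  fix v assume "v \<in> vars p"
  with p have "v \<in> KS_vars k n r" ..
  then show "psubst (KS_subst n r) (supp_subst n r v) = Var v"
  proof (cases rule: KS_vars_cases)
    case X
    then show ?thesis
      by (simp add: supp_subst_def psubst_Var KS_subst_def)
  next
    case (Y i j)
    show ?thesis
      unfolding Y(1) by (simp add: supp_subst_def psubst_sign_Var KS_subst_Tij[OF r Y(2,3)])
  qed
qed

lemma supp_KS_subst:
  assumes r: "r \<le> n" and p: "vars p \<subseteq> tilde_vars k n r"
  shows "psubst (supp_subst n r) (psubst (KS_subst n r) p) = p"
  unfolding psubst_psubst
proof (rule psubst_fix)
  fix v assume "v \<in> vars p"
  with p have "v \<in> tilde_vars k n r" ..
  then show "psubst (supp_subst n r) (KS_subst n r v) = Var v"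
  proof (cases rule: tilde_vars_cases)
    case X
    then show ?thesis
      by (simp add: supp_subst_def psubst_Var KS_subst_def)
  next
    case (C i j)
    show ?thesis
      unfolding C(1) KS_subst_Tij[OF r C(2,3)] by (simp add: supp_subst_def psubst_sign_Var)
  qed
qed

lemma vars_supp_subst:
  fixes v
  assumes "v \<in> KS_vars k n r"
  shows "vars (supp_subst n r v :: 'a::comm_ring_1 mpoly) \<subseteq> tilde_vars k n r"
using assms
proof (cases rule: KS_vars_cases)
  case (X i)
  then show ?thesis
    using base_subset_tilde_vars[of k n r] by (auto simp: supp_subst_def)
next
  case (Y i j)
  have "vars ((- 1) ^ i * Var (CV (Tij n r i j)) :: 'a mpoly) \<subseteq> tilde_vars k n r"
    using Tij_mem_tilde_vars[OF Y(2,3)] by (intro vars_mult_subset vars_power_subset) simp_all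
  then show ?thesis
    by (simp add: supp_subst_def Y(1))
qed

lemma vars_KS_subst_tilde:
  assumes "r \<le> n" "vars p \<subseteq> tilde_vars k n r"
  shows "vars (psubst (KS_subst n r) p) \<subseteq> KS_vars k n r"
  using assms tilde_vars_subset[OF assms(1), of k] by (intro vars_psubst vars_KS_subst) blast

lemma is_Phi_KS_subst:
  assumes r: "r \<le> n"
  shows "is_Phi k n r (psubst (KS_subst n r) :: 'a::comm_ring_1 mpoly \<Rightarrow> _)"
  unfolding is_Phi_def
proof (intro conjI allI ballI)
  interpret s: comm_ring_hom "psubst (KS_subst n r) :: 'a mpoly \<Rightarrow> _" by (rule comm_ring_hom_psubst)
  show "psubst (KS_subst n r) \<in> ring_iso (R_supp_tilde k n r) (R_KS k n r :: 'a mpoly ring)"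
    unfolding R_supp_tilde_eq R_KS_eq
  proof (rule ring_iso_memI)
    show "bij_betw (psubst (KS_subst n r)) (carrier (PolyR (tilde_vars k n r)))
        (carrier (PolyR (KS_vars k n r)) :: 'a mpoly set)"
    proof (rule bij_betw_byWitness[where f' = "psubst (supp_subst n r)"])
      show "psubst (supp_subst n r) ` carrier (PolyR (KS_vars k n r)) \<subseteq>
          (carrier (PolyR (tilde_vars k n r)) :: 'a mpoly set)"
        unfolding carrier_PolyR using vars_supp_subst by (intro image_subsetI CollectI vars_psubst) blast
    qed (simp_all add: carrier_PolyR supp_KS_subst[OF r] KS_supp_subst[OF r]
        vars_KS_subst_tilde[OF r] image_subset_iff)
  qed (simp_all add: carrier_PolyR s.hom_add s.hom_mult vars_KS_subst_tilde[OF r])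
qed (use r KS_subst_Tij in \<open>auto simp: psubst_Const psubst_Var KS_subst_def set_minor_KS_mat_Tij\<close>)

text \<open>
  The conditions on \<open>\<Phi>\<close> determine it on the domain that matters, so one map can be used for all of them.
\<close>

lemma is_Phi_eq_KS_subst:
  assumes r: "r \<le> n" and \<Phi>: "is_Phi k n r \<Phi>" and p: "vars p \<subseteq> tilde_vars k n r"
  shows "\<Phi> p = psubst (KS_subst n r) p"
  using p
proof (induction rule: PolyR_induct)
  interpret s: comm_ring_hom "psubst (KS_subst n r) :: 'a mpoly \<Rightarrow> _" by (rule comm_ring_hom_psubst)
  have hom: "\<Phi> \<in> Ring.ring_hom (PolyR (tilde_vars k n r)) (PolyR (KS_vars k n r))"
    using \<Phi> by (simp add: is_Phi_def ring_iso_def R_supp_tilde_eq R_KS_eq)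
  {
    case (Const c)
    show ?case using \<Phi> by (simp add: is_Phi_def psubst_Const)
  next
    case (Var v)
    then show ?case
    proof (cases rule: tilde_vars_cases)
      case (X i)
      then show ?thesis
        using \<Phi> by (simp add: is_Phi_def psubst_Var KS_subst_def)
    next
      case (C i j)
      then show ?thesis
        using \<Phi> by (simp add: is_Phi_def psubst_Var KS_subst_Tij[OF r])
    qed
  next
    case (add p q)
    then show ?case
      using ring_hom_add[OF hom, of p q] by (simp add: carrier_PolyR s.hom_add)
  next
    case (mult p q)
    then show ?case
      using ring_hom_mult[OF hom, of p q] by (simp add: carrier_PolyR s.hom_mult)
  }
qed

text \<open>
  The image of an ideal under a retraction onto a subring is an ideal of that subring.
\<close>

lemma poly_ideal_I_supp:
  fixes M :: "nat \<Rightarrow> 'a::comm_ring_1 mat"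
  assumes r: "r \<le> n"
  shows "poly_ideal (XV ` {1..k} \<union> CV ` (\<P> r n - {T0 n r})) (I_supp k m n r M)"
  unfolding poly_ideal_def
proof (rule idealI_PolyR)
  let ?\<kappa> = "\<lambda>v. if v = CV (T0 n r) then 1 else Var v :: 'a mpoly"
  interpret s: comm_ring_hom "psubst ?\<kappa>" by (rule comm_ring_hom_psubst)
  interpret Gb: poly_ideal "XV ` {1..k} \<union> CV ` \<P> r n" "I_suppGb k m n r M"
    by (rule poly_ideal_suppGb)
  note I_supp_def [simp]
  show "vars p \<subseteq> XV ` {1..k} \<union> CV ` (\<P> r n - {T0 n r})" if "p \<in> I_supp k m n r M" for p
  proof -
    obtain g where g: "g \<in> I_suppGb k m n r M" "p = psubst ?\<kappa> g"
      using \<open>p \<in> I_supp k m n r M\<close> by auto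
    show ?thesis
      unfolding g(2) using Gb.vars_mem[OF g(1)] by (intro vars_psubst) auto
  qed
  show "0 \<in> I_supp k m n r M"
    using Gb.zero_mem by (auto intro!: image_eqI[of _ _ 0])
  show "p + q \<in> I_supp k m n r M" if "p \<in> I_supp k m n r M" "q \<in> I_supp k m n r M" for p q
    using that Gb.add_mem by (auto simp flip: s.hom_add)
  show "a * p \<in> I_supp k m n r M"
    if a: "vars a \<subseteq> XV ` {1..k} \<union> CV ` (\<P> r n - {T0 n r})" and p: "p \<in> I_supp k m n r M" for a p
  proof -
    obtain g where g: "g \<in> I_suppGb k m n r M" "p = psubst ?\<kappa> g"
      using p by auto
    have "psubst ?\<kappa> a = a"
      using a by (intro psubst_fix) auto
    then have "a * p = psubst ?\<kappa> (a * g)"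
      by (simp add: s.hom_mult g)
    moreover have "a * g \<in> I_suppGb k m n r M"
      using a by (intro Gb.mult_mem g) auto
    ultimately show ?thesis
      by auto
  qed
qed

lemma supp_subst_I_KS:
  assumes r: "r \<le> n" and p: "p \<in> I_KS k m n r M"
  shows "psubst (supp_subst n r) p \<in> I_supp k m n r M"
  using p r
proof (induction rule: I_KS_induct)
  interpret s: comm_ring_hom "psubst (supp_subst n r) :: 'a mpoly \<Rightarrow> _" by (rule comm_ring_hom_psubst)
  interpret supp: poly_ideal "XV ` {1..k} \<union> CV ` (\<P> r n - {T0 n r})" "I_supp k m n r M"
    by (rule poly_ideal_I_supp[OF r])
  {
    case zero
    show ?case by (simp add: supp.zero_mem)
  next
    case (gen i j)
    let ?u = "u_entry k m n M"
    let ?\<kappa> = "\<lambda>v. if v = CV (T0 n r) then 1 else Var v :: 'a mpoly"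
    have u: "psubst (supp_subst n r) (?u i j) = ?u i j" if "j \<in> {1..n}" for j
      using gen that by (intro psubst_u_entry) (auto simp: supp_subst_def)
    have "j \<in> {1..n}" and "\<And>l. l \<in> {1..r} \<Longrightarrow> n - r + l \<in> {1..n}"
      using gen r by auto
    note u = u[OF this(1)] u[OF this(2)]
    have "psubst (supp_subst n r) (f_KS k m n r M i j) =
        ?u i j + (\<Sum>l = 1..r. ?u i (n - r + l) * ((- 1) ^ l * Var (CV (Tij n r l j))))"
      by (simp only: f_KS_def s.hom_add s.hom_sum s.hom_mult u psubst_Var supp_subst_def var.case
          cong: sum.cong)
    also have "\<dots> = support_form ?u (\<lambda>T. ?\<kappa> (CV T)) i (insert j (T0 n r))"
      unfolding support_form_T0[OF r gen(2)] using Tij_mem[OF r _ gen(2)]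
      by (auto simp: mult_ac intro!: sum.cong)
    also have "\<dots> = psubst ?\<kappa> (support_form ?u (\<lambda>T. Var (CV T)) i (insert j (T0 n r)))"
      using gen insert_T0_mem[OF r gen(2)]
      by (subst psubst_support_form) (auto simp: psubst_Var subsets_of_card_def)
    also have "\<dots> \<in> I_supp k m n r M"
      unfolding I_supp_def using gen insert_T0_mem[OF r gen(2)]
      by (intro imageI support_form_mem_I_suppGb)
    finally show ?case .
  next
    case (add p q)
    then show ?case by (simp add: s.hom_add supp.add_mem)
  next
    case (mult a p)
    have "vars (psubst (supp_subst n r) a) \<subseteq> tilde_vars k n r"
      using mult(1) vars_supp_subst by (intro vars_psubst) blast
    then show ?case
      unfolding s.hom_mult using mult(2) tilde_vars_subset[OF r, of k]
      by (intro supp.mult_mem) auto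
  }
qed

text \<open>
  Setting \<open>C = 1\<close> at \<open>T\<^sub>0\<close> does not change the effect of the substitution by minors of \<open>Q\<close>, so an element
  of \<open>I\<^sub>s\<^sub>u\<^sub>p\<^sub>p\<close> has the same image as any preimage in \<open>I\<^sub>s\<^sub>u\<^sub>p\<^sub>p\<^sup>G\<^sup>b\<close>. This accounts for relations of
  \<open>I\<^sub>s\<^sub>u\<^sub>p\<^sub>p\<close> whose derivation involves variables outside the subring.
\<close>

lemma Phi_image_I_supp:
  fixes M :: "nat \<Rightarrow> 'a::comm_ring_1 mat"
  assumes r: "r \<le> n" and \<Phi>: "is_Phi k n r \<Phi>"
  shows "\<Phi> ` (I_supp k m n r M \<inter> carrier (R_supp_tilde k n r)) = I_KS k m n r M"
proof (intro equalityI subsetI)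
  fix q assume "q \<in> \<Phi> ` (I_supp k m n r M \<inter> carrier (R_supp_tilde k n r))"
  then obtain p where p: "p \<in> I_supp k m n r M" "vars p \<subseteq> tilde_vars k n r" "q = \<Phi> p"
    by (auto simp: R_supp_tilde_eq carrier_PolyR)
  then obtain g where g: "g \<in> I_suppGb k m n r M"
    "p = psubst (\<lambda>v. if v = CV (T0 n r) then 1 else Var v) g"
    by (auto simp: I_supp_def)
  interpret s: comm_ring_hom "psubst (KS_subst n r) :: 'a mpoly \<Rightarrow> _" by (rule comm_ring_hom_psubst)
  have "(\<lambda>v. psubst (KS_subst n r) (if v = CV (T0 n r) then 1 else Var v)) =
      (KS_subst n r :: var \<Rightarrow> 'a mpoly)"
    using set_minor_KS_mat_T0[OF r, where 'a = 'a] by (auto simp: psubst_Var KS_subst_def)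
  then have "q = psubst (KS_subst n r) g"
    using is_Phi_eq_KS_subst[OF r \<Phi> p(2)] p(3) g(2) by (simp add: psubst_psubst)
  then show "q \<in> I_KS k m n r M"
    using KS_subst_I_suppGb[OF r g(1)] by simp
next
  fix q assume q: "q \<in> I_KS k m n r M"
  let ?p = "psubst (supp_subst n r) q"
  have vars: "vars q \<subseteq> KS_vars k n r"
    by (rule poly_ideal.vars_mem[OF poly_ideal_KS[OF r] q])
  then have p: "vars ?p \<subseteq> tilde_vars k n r"
    using vars_supp_subst by (intro vars_psubst) blast
  have "\<Phi> ?p = q"
    using is_Phi_eq_KS_subst[OF r \<Phi> p] KS_supp_subst[OF r vars] by simp
  then show "q \<in> \<Phi> ` (I_supp k m n r M \<inter> carrier (R_supp_tilde k n r))"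
    using supp_subst_I_KS[OF r q] p by (intro image_eqI[of _ _ ?p]) (auto simp: R_supp_tilde_eq carrier_PolyR)
qed

section \<open>Inverting a maximal minor\<close>

lemma localiseI: "p \<in> S \<Longrightarrow> Fract p (\<Delta> ^ e) \<in> localise \<Delta> S"
  unfolding localise_def by blast

lemma Fract_1_mem_localise: "p \<in> S \<Longrightarrow> Fract p 1 \<in> localise \<Delta> S"
  using localiseI[of p S \<Delta> 0] by simp

lemma Fract_mem_localise: "p \<in> S \<Longrightarrow> Fract p \<Delta> \<in> localise \<Delta> S"
  using localiseI[of p S \<Delta> 1] by simp

context
  fixes \<Delta> :: "'c::idom" and S :: "'c set"
  assumes \<Delta>: "\<Delta> \<noteq> 0"
begin

lemma localise_add:
  assumes "\<And>p q. p \<in> S \<Longrightarrow> q \<in> S \<Longrightarrow> p + q \<in> S" "\<And>p e. p \<in> S \<Longrightarrow> p * \<Delta> ^ e \<in> S"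
    and "x \<in> localise \<Delta> S" "y \<in> localise \<Delta> S"
  shows "x + y \<in> localise \<Delta> S"
proof -
  obtain f d g e where fg: "x = Fract f (\<Delta> ^ d)" "f \<in> S" "y = Fract g (\<Delta> ^ e)" "g \<in> S"
    using assms by (auto simp: localise_def)
  then have "x + y = Fract (f * \<Delta> ^ e + g * \<Delta> ^ d) (\<Delta> ^ (d + e))"
    using \<Delta> by (simp add: power_add)
  then show ?thesis
    using assms fg unfolding localise_def by blast
qed

lemma localise_mult:
  assumes "\<And>p q. p \<in> R \<Longrightarrow> q \<in> S \<Longrightarrow> p * q \<in> S" and "x \<in> localise \<Delta> R" "y \<in> localise \<Delta> S"
  shows "x * y \<in> localise \<Delta> S"
proof -
  obtain f d g e where fg: "x = Fract f (\<Delta> ^ d)" "f \<in> R" "y = Fract g (\<Delta> ^ e)" "g \<in> S"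
    using assms by (auto simp: localise_def)
  then have "x * y = Fract (f * g) (\<Delta> ^ (d + e))"
    by (simp add: power_add)
  then show ?thesis
    using assms fg unfolding localise_def by blast
qed

end

lemma comm_ring_hom_Fract: "comm_ring_hom (\<lambda>p::'c::idom. Fract p 1)"
  by standard (simp_all add: Zero_fract_def One_fract_def)

text \<open>
  Up to sign the support form is the minor of \<open>u\<close> with row \<open>i\<close> added, or zero if that row is already
  present.
\<close>

lemma support_form_set_minor_mem_I_minors:
  assumes I: "I \<in> \<P> r m" and S: "S \<in> \<P> (r + 1) n" and i: "i \<in> {1..m}"
  shows "support_form (u_entry k m n M) (set_minor (u_entry k m n M) I) i S \<in> I_minors k m n r M"
proof -
  interpret minors: poly_ideal "XV ` {1..k}" "I_minors k m n r M"
    by (rule poly_ideal_minors)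
  let ?u = "u_entry k m n M"
  have fin: "finite I" "finite S" and card: "card I = r" "card S = Suc (card I)"
    using I S by (auto simp: subsets_of_card_def intro: finite_subset)
  show ?thesis
  proof (cases "i \<in> I")
    case True
    then show ?thesis
      using fin card by (simp add: support_form_set_minor_zero minors.zero_mem)
  next
    case False
    then have "insert i I \<in> \<P> (r + 1) m"
      using I i fin card by (auto simp: subsets_of_card_def)
    then have "set_minor ?u (insert i I) S \<in> I_minors k m n r M"
      using S by (rule set_minor_mem_I_minors)
    then show ?thesis
      unfolding support_form_set_minor_border[OF fin(1) False fin(2) card(2)] minors.sign_mult_mem_iff .
  qed
qed

context
  fixes k m n r :: nat and M :: "nat \<Rightarrow> 'a::field mat" and I :: "nat set" and \<Delta> :: "'a mpoly"
  assumes r: "r \<le> n" and I: "I \<in> \<P> r m"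
    and \<Delta>_def: "\<Delta> = set_minor (u_entry k m n M) I (T0 n r)" and \<Delta>: "\<Delta> \<noteq> 0"
begin

text \<open>
  By Cramer's rule, the values at \<open>y\<^sub>l\<^sub>,\<^sub>j\<close> are the solution of the Kipnis-Shamir equations of the rows \<open>I\<close>
  over the fraction field.
\<close>

definition cramer :: "var \<Rightarrow> 'a mpoly fract"
  where "cramer v = (case v of
    YV l j \<Rightarrow> Fract ((- 1) ^ l * set_minor (u_entry k m n M) I (Tij n r l j)) \<Delta>
  | _ \<Rightarrow> Fract (Var v) 1)"

abbreviation (input) cramer_eval :: "'a mpoly \<Rightarrow> 'a mpoly fract"
  where "cramer_eval \<equiv> peval (\<lambda>c. Fract (Const c) 1) cramer"

lemma comm_ring_hom_Fract_Const: "comm_ring_hom (\<lambda>c::'a. Fract (Const c) 1)"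
proof -
  interpret F: comm_ring_hom "\<lambda>p::'a mpoly. Fract p 1" by (rule comm_ring_hom_Fract)
  interpret C: comm_ring_hom "Const :: 'a \<Rightarrow> _" by (rule comm_ring_hom_Const)
  show ?thesis
    by standard (simp_all only: C.hom_add C.hom_mult C.hom_zero C.hom_one F.hom_add F.hom_mult F.hom_zero F.hom_one)
qed

lemma cramer_eval_base:
  assumes "vars p \<subseteq> XV ` {1..k}"
  shows "cramer_eval p = Fract p 1"
  by (rule hom_eq_on_PolyR[OF comm_ring_hom_peval[OF comm_ring_hom_Fract_Const] comm_ring_hom_Fract assms])
    (auto simp: peval_Const[OF comm_ring_hom_Fract_Const] peval_Var[OF comm_ring_hom_Fract_Const] cramer_def)

lemma vars_\<Delta>: "vars \<Delta> \<subseteq> XV ` {1..k}"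
  unfolding \<Delta>_def by (rule vars_set_minor_u_entry[OF I T0_mem[OF r] subset_refl])

lemma cramer_eval_KS:
  assumes "vars p \<subseteq> KS_vars k n r"
  shows "cramer_eval p \<in> localise \<Delta> {p. vars p \<subseteq> XV ` {1..k}}"
  using assms
proof (induction rule: PolyR_induct)
  interpret ev: comm_ring_hom cramer_eval
    by (rule comm_ring_hom_peval[OF comm_ring_hom_Fract_Const])
  {
    case (Const c)
    show ?case
      by (simp add: cramer_eval_base Fract_1_mem_localise)
  next
    case (Var v)
    then show ?case
    proof (cases rule: KS_vars_cases)
      case (X i)
      then show ?thesis
        by (simp add: cramer_eval_base Fract_1_mem_localise)
    next
      case (Y l j)
      let ?p = "(- 1) ^ l * set_minor (u_entry k m n M) I (Tij n r l j)"
      have "vars ?p \<subseteq> XV ` {1..k}"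
        using Tij_mem[OF r Y(2,3)] by (intro vars_mult_subset vars_power_subset vars_set_minor_u_entry[OF I]) auto
      then show ?thesis
        by (simp add: peval_Var[OF comm_ring_hom_Fract_Const] cramer_def Y(1) Fract_mem_localise)
    qed
  next
    case (add p q)
    show ?case
      unfolding ev.hom_add using add(3,4) vars_\<Delta>
      by (intro localise_add[OF \<Delta>]) (simp_all add: vars_add_subset vars_mult_subset vars_power_subset)
  next
    case (mult p q)
    show ?case
      unfolding ev.hom_mult using mult(3,4)
      by (intro localise_mult[OF \<Delta>]) (simp_all add: vars_mult_subset)
  }
qed

text \<open>
  At the Cramer solution, \<open>\<Delta> f\<^sub>i\<^sub>,\<^sub>j\<close> is the support form of \<open>T\<^sub>0 \<union> {j}\<close> with the minors of the rows \<open>I\<close>.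
\<close>

lemma cramer_eval_I_KS:
  assumes p: "p \<in> I_KS k m n r M"
  shows "cramer_eval p \<in> localise \<Delta> (I_minors k m n r M)"
  using p r
proof (induction rule: I_KS_induct)
  interpret ev: comm_ring_hom cramer_eval
    by (rule comm_ring_hom_peval[OF comm_ring_hom_Fract_Const])
  interpret F: comm_ring_hom "\<lambda>p::'a mpoly. Fract p 1" by (rule comm_ring_hom_Fract)
  interpret minors: poly_ideal "XV ` {1..k}" "I_minors k m n r M"
    by (rule poly_ideal_minors)
  {
    case zero
    show ?case
      unfolding ev.hom_zero Zero_fract_def by (intro Fract_1_mem_localise minors.zero_mem)
  next
    case (gen i j)
    let ?u = "u_entry k m n M"
    let ?C = "set_minor ?u I"
    have u: "cramer_eval (?u i j) = Fract (?u i j) 1" if "j \<in> {1..n}" for j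
      by (rule cramer_eval_base[OF vars_u_entry[OF gen(1) that subset_refl]])
    have "j \<in> {1..n}" and "\<And>l. l \<in> {1..r} \<Longrightarrow> n - r + l \<in> {1..n}"
      using gen r by auto
    note u = u[OF this(1)] u[OF this(2)]
    have "cramer_eval (f_KS k m n r M i j) = Fract (?u i j) 1 +
        (\<Sum>l = 1..r. Fract (?u i (n - r + l)) 1 * Fract ((- 1) ^ l * ?C (Tij n r l j)) \<Delta>)"
      by (simp only: f_KS_def ev.hom_add ev.hom_sum ev.hom_mult u var.case
          peval_Var[OF comm_ring_hom_Fract_Const] cramer_def cong: sum.cong)
    also have "Fract (?u i j) 1 = Fract (?u i j * ?C (T0 n r)) 1 * Fract 1 \<Delta>"
      using \<Delta> by (simp add: eq_fract \<Delta>_def)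
    also have "(\<Sum>l = 1..r. Fract (?u i (n - r + l)) 1 * Fract ((- 1) ^ l * ?C (Tij n r l j)) \<Delta>) =
        (\<Sum>l = 1..r. Fract ((- 1) ^ l * ?u i (n - r + l) * ?C (Tij n r l j)) 1 * Fract 1 \<Delta>)"
      by (intro sum.cong) (simp_all add: mult_ac)
    also have "Fract (?u i j * ?C (T0 n r)) 1 * Fract 1 \<Delta> + \<dots> = Fract (support_form ?u ?C i (insert j (T0 n r))) 1 * Fract 1 \<Delta>"
      unfolding support_form_T0[OF r gen(2)] F.hom_add F.hom_sum distrib_right sum_distrib_right ..
    also have "\<dots> = Fract (support_form ?u ?C i (insert j (T0 n r))) \<Delta>"
      by simp
    also have "\<dots> \<in> localise \<Delta> (I_minors k m n r M)"
      by (intro Fract_mem_localise support_form_set_minor_mem_I_minors[OF I insert_T0_mem[OF r gen(2)] gen(1)])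
    finally show ?case .
  next
    case (add p q)
    then show ?case
      unfolding ev.hom_add using vars_\<Delta>
      by (intro localise_add[OF \<Delta>] minors.add_mem minors.mult_mem_right vars_power_subset)
  next
    case (mult a p)
    show ?case
      unfolding ev.hom_mult using cramer_eval_KS[OF mult(1)] mult(2)
      by (rule localise_mult[OF \<Delta>, rotated]) (simp add: minors.mult_mem)
  }
qed

text \<open>
  If \<open>f / \<Delta>\<^sup>e = g / \<Delta>\<^sup>d\<close> with \<open>f \<in> I\<^sub>K\<^sub>S\<close> and \<open>g\<close> free of the \<open>y\<^sub>l\<^sub>,\<^sub>j\<close>, evaluation at the Cramer solution leaves
  the right-hand side unchanged and moves the left-hand side into the localised ideal of minors.
\<close>

lemma localise_I_minors:
  "localise \<Delta> (I_minors k m n r M) =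
    localise \<Delta> (I_KS k m n r M) \<inter> localise \<Delta> (carrier (R_base k))"
proof (intro equalityI subsetI)
  fix x assume "x \<in> localise \<Delta> (I_minors k m n r M)"
  then show "x \<in> localise \<Delta> (I_KS k m n r M) \<inter> localise \<Delta> (carrier (R_base k))"
    using I_minors_subset_I_KS[OF r] poly_ideal.vars_mem[OF poly_ideal_minors]
    unfolding localise_def R_base_def carrier_PolyR by fast
next
  interpret ev: comm_ring_hom cramer_eval
    by (rule comm_ring_hom_peval[OF comm_ring_hom_Fract_Const])
  fix x assume "x \<in> localise \<Delta> (I_KS k m n r M) \<inter> localise \<Delta> (carrier (R_base k))"
  then have x: "x \<in> localise \<Delta> (I_KS k m n r M)" "x \<in> localise \<Delta> (carrier (R_base k))"
    by blast+
  obtain f e where f: "f \<in> I_KS k m n r M" "x = Fract f (\<Delta> ^ e)"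
    using x(1) unfolding localise_def by blast
  obtain g d where g: "vars g \<subseteq> XV ` {1..k}" "x = Fract g (\<Delta> ^ d)"
    using x(2) unfolding localise_def R_base_def carrier_PolyR by blast
  obtain b c where b: "b \<in> I_minors k m n r M" "cramer_eval f = Fract b (\<Delta> ^ c)"
    using cramer_eval_I_KS[OF f(1)] by (auto simp: localise_def)
  have "f * \<Delta> ^ d = g * \<Delta> ^ e"
    using f(2) g(2) \<Delta> by (simp add: eq_fract)
  then have "cramer_eval f * cramer_eval (\<Delta> ^ d) = cramer_eval (g * \<Delta> ^ e)"
    by (metis ev.hom_mult)
  moreover have "cramer_eval (\<Delta> ^ d) = Fract (\<Delta> ^ d) 1"
    by (intro cramer_eval_base vars_power_subset vars_\<Delta>)
  moreover have "cramer_eval (g * \<Delta> ^ e) = Fract (g * \<Delta> ^ e) 1"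
    by (intro cramer_eval_base vars_mult_subset g vars_power_subset vars_\<Delta>)
  ultimately have "b * \<Delta> ^ d = g * \<Delta> ^ (c + e)"
    using b(2) \<Delta> by (simp add: eq_fract power_add mult_ac)
  then have "x = Fract b (\<Delta> ^ (c + e))"
    using g(2) \<Delta> by (simp add: eq_fract)
  then show "x \<in> localise \<Delta> (I_minors k m n r M)"
    unfolding localise_def using b(1) by blast
qed

end

section \<open>The Nullstellensatz over a finite field\<close>

text \<open>
  Multiplication by \<open>x \<noteq> 0\<close> permutes the nonzero elements, so it does not change their product.
\<close>

lemma power_card_eq_same:
  fixes x :: "'a::{field, finite}"
  shows "x ^ CARD('a) = x"
proof (cases "x = 0")
  case False
  have "(\<Prod>y\<in>UNIV - {0}. x * y) = (\<Prod>y\<in>UNIV - {0}. y)"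
    by (rule prod.reindex_bij_witness[of _ "\<lambda>y. y / x" "\<lambda>y. x * y"]) (use False in auto)
  then have "x ^ (CARD('a) - 1) = 1"
    by (simp add: prod.distrib)
  moreover have "CARD('a) = Suc (CARD('a) - 1)"
    by (simp add: card_gt_0_iff)
  ultimately show ?thesis
    by (metis mult.right_neutral power_Suc)
qed (simp add: card_gt_0_iff)

context
  fixes x :: "'a::{field, finite} mpoly"
begin

lemma inj_Const: "inj (Const :: 'a \<Rightarrow> 'a mpoly)"
  by (rule injI) (metis Const_def lookup_single_eq)

text \<open>
  Both sides are values at \<open>x\<close> of monic polynomials of degree \<open>q\<close> that agree at the \<open>q\<close> constants.
\<close>

lemma power_card_minus_eq_prod: "x ^ CARD('a) - x = (\<Prod>d\<in>UNIV. x - Const d)"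
proof -
  interpret C: comm_ring_hom "Const :: 'a \<Rightarrow> 'a mpoly" by (rule comm_ring_hom_Const)
  let ?P = "Polynomial.monom 1 CARD('a) - [:0, 1:] :: 'a mpoly poly"
  let ?Q = "\<Prod>d\<in>(UNIV :: 'a set). [:- Const d, 1:]"
  have q: "CARD('a) \<ge> 2"
    using card_mono[of UNIV "{0, 1 :: 'a}"] by simp
  have deg: "Polynomial.degree ?Q = CARD('a)"
    by (subst degree_prod_sum_eq) auto
  have "?P = ?Q"
  proof (rule poly_eqI_degree_lead_coeff)
    have "Polynomial.coeff ?Q CARD('a) = Polynomial.lead_coeff ?Q"
      by (simp only: deg)
    also have "\<dots> = 1"
      by (simp add: lead_coeff_prod)
    finally show "Polynomial.coeff ?P CARD('a) = Polynomial.coeff ?Q CARD('a)"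
      using q by (simp add: coeff_pCons split: nat.split)
    show "CARD('a) \<le> card (range (Const :: 'a \<Rightarrow> 'a mpoly))"
      by (simp add: card_image inj_Const)
    show "Polynomial.degree ?P \<le> CARD('a)"
      using q by (intro degree_diff_le degree_monom_le) simp
    show "poly ?P z = poly ?Q z" if "z \<in> range Const" for z
      using that by (auto simp: poly_monom poly_prod power_card_eq_same simp flip: C.hom_power)
  qed (simp add: deg)
  then have "poly ?P x = poly ?Q x"
    by simp
  then show ?thesis
    by (simp add: poly_monom poly_prod)
qed

text \<open>
  Lagrange interpolation of the constant \<open>1\<close> at all elements of the field.
\<close>

lemma lagrange_sum_eq_1:
  "(\<Sum>c\<in>UNIV. Const (\<Prod>d\<in>UNIV - {c}. inverse (c - d)) * (\<Prod>d\<in>UNIV - {c}. x - Const d)) = 1"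
proof -
  interpret C: comm_ring_hom "Const :: 'a \<Rightarrow> 'a mpoly" by (rule comm_ring_hom_Const)
  let ?k = "\<lambda>c. Const (\<Prod>d\<in>UNIV - {c}. inverse (c - d)) :: 'a mpoly"
  let ?P = "\<Sum>c\<in>(UNIV :: 'a set). Polynomial.smult (?k c) (\<Prod>d\<in>UNIV - {c}. [:- Const d, 1:])"
  have deg: "Polynomial.degree (\<Prod>d\<in>UNIV - {c}. [:- Const d, 1:]) = CARD('a) - 1" for c :: 'a
    by (subst degree_prod_sum_eq) auto
  have "?P = 1"
  proof (rule poly_eqI_degree)
    have card: "card (range (Const :: 'a \<Rightarrow> 'a mpoly)) = CARD('a)"
      by (simp add: card_image inj_Const)
    have "Polynomial.degree ?P \<le> CARD('a) - 1"
      by (intro degree_sum_le order.trans[OF degree_smult_le]) (simp_all add: deg)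
    then show "Polynomial.degree ?P < card (range (Const :: 'a \<Rightarrow> 'a mpoly))"
      unfolding card using zero_less_card_finite[where 'a = 'a] by linarith
    show "Polynomial.degree (1 :: 'a mpoly poly) < card (range (Const :: 'a \<Rightarrow> 'a mpoly))"
      unfolding card by (simp add: card_gt_0_iff)
    show "poly ?P z = poly 1 z" if z: "z \<in> range Const" for z
    proof -
      obtain b where b: "z = Const b"
        using z by auto
      have "?k c * (\<Prod>d\<in>UNIV - {c}. z - Const d) = (if c = b then 1 else 0)" for c
      proof (cases "c = b")
        case True
        have "(\<Prod>d\<in>UNIV - {b}. inverse (b - d)) * (\<Prod>d\<in>UNIV - {b}. b - d) = 1"
          by (simp flip: prod.distrib)
        then show ?thesis
          by (simp add: b True flip: C.hom_minus C.hom_prod C.hom_mult)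
      next
        case False
        then have "(\<Prod>d\<in>UNIV - {c}. z - Const d) = 0"
          by (auto simp: b)
        then show ?thesis
          using False by simp
      qed
      then show ?thesis
        by (simp add: poly_sum poly_prod)
    qed
  qed
  then have "poly ?P x = 1"
    by simp
  then show ?thesis
    by (simp add: poly_sum poly_prod)
qed

end

text \<open>
  Multiply \<open>f\<close> by the Lagrange partition of unity: the summand at \<open>c\<close> turns the factor \<open>x - c\<close> into
  \<open>x\<^sup>q - x\<close>, which lies in \<open>J\<close>.
\<close>

lemma mem_of_mem_at_values:
  fixes J :: "'a::{field, finite} mpoly set"
  assumes J: "poly_ideal V J" and v: "v \<in> V" and eq: "Var v ^ CARD('a) - Var v \<in> J"
    and f: "\<And>c. \<exists>g a. g \<in> J \<and> vars a \<subseteq> V \<and> f = g + (Var v - Const c) * a"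
  shows "f \<in> J"
proof -
  interpret poly_ideal V J by (rule J)
  let ?x = "Var v :: 'a mpoly"
  let ?L = "\<lambda>c. \<Prod>d\<in>UNIV - {c}. ?x - Const d"
  have L: "vars (?L c) \<subseteq> V" for c
    using v by (intro vars_prod_subset vars_diff_subset) auto
  have mem: "?L c * f \<in> J" for c
  proof -
    obtain g a where ga: "g \<in> J" "vars a \<subseteq> V" "f = g + (?x - Const c) * a"
      using f by blast
    have "(?x - Const c) * ?L c = ?x ^ CARD('a) - ?x"
      unfolding power_card_minus_eq_prod by (simp add: prod.remove[of UNIV c])
    then have "?L c * f = ?L c * g + (?x ^ CARD('a) - ?x) * a"
      unfolding ga(3) by (simp add: distrib_left flip: mult.assoc) (simp add: mult.commute)
    then show ?thesis
      using ga L eq by (simp add: add_mem mult_mem mult_mem_right)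
  qed
  have "f = (\<Sum>c\<in>UNIV. Const (\<Prod>d\<in>UNIV - {c}. inverse (c - d)) * ?L c) * f"
    by (simp add: lagrange_sum_eq_1)
  also have "\<dots> = (\<Sum>c\<in>UNIV. Const (\<Prod>d\<in>UNIV - {c}. inverse (c - d)) * (?L c * f))"
    by (simp add: sum_distrib_right mult.assoc)
  also have "\<dots> \<in> J"
    by (intro sum_mem mult_mem mem) simp
  finally show ?thesis .
qed

text \<open>
  Membership can be tested after imposing \<open>v = a v\<close> for all variables of a finite set, for every choice of
  values \<open>a\<close>. Quantification over all larger ideals \<open>J'\<close> lets the variables be treated one at a time.
\<close>

lemma mem_of_mem_at_points:
  fixes J :: "'a::{field, finite} mpoly set"
  assumes "finite W" "W \<subseteq> V" "poly_ideal V J" "\<And>v. v \<in> W \<Longrightarrow> Var v ^ CARD('a) - Var v \<in> J"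
    and "\<And>a J'. poly_ideal V J' \<Longrightarrow> J \<subseteq> J' \<Longrightarrow> (\<And>v. v \<in> W \<Longrightarrow> Var v - Const (a v) \<in> J') \<Longrightarrow> f \<in> J'"
  shows "f \<in> J"
  using assms
proof (induction W arbitrary: J rule: finite_induct)
  case empty
  then show ?case by blast
next
  case (insert v W J)
  interpret poly_ideal V J by (rule insert.prems(2))
  have v: "v \<in> V"
    using insert.prems by simp
  show ?case
  proof (rule mem_of_mem_at_values[OF insert.prems(2) v])
    fix c :: 'a
    let ?J = "{g + (Var v - Const c) * a |g a. g \<in> J \<and> vars a \<subseteq> V}"
    have lin: "vars (Var v - Const c) \<subseteq> V"
      using v by (intro vars_diff_subset) auto
    have "ideal ?J (PolyR V)"
    proof (rule idealI_PolyR)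
      show "vars p \<subseteq> V" if "p \<in> ?J" for p
      proof -
        obtain g a where "p = g + (Var v - Const c) * a" "g \<in> J" "vars a \<subseteq> V"
          using \<open>p \<in> ?J\<close> by blast
        then show ?thesis
          using vars_mem lin by (simp add: vars_add_subset vars_mult_subset)
      qed
      show "0 \<in> ?J"
        using zero_mem by (auto intro!: exI[of _ "0 :: 'a mpoly"])
      show "p + q \<in> ?J" if pq: "p \<in> ?J" "q \<in> ?J" for p q
      proof -
        obtain g a h b where p: "p = g + (Var v - Const c) * a" "g \<in> J" "vars a \<subseteq> V"
          and q: "q = h + (Var v - Const c) * b" "h \<in> J" "vars b \<subseteq> V"
          using pq by blast
        have "p + q = (g + h) + (Var v - Const c) * (a + b)"
          by (simp add: p(1) q(1) distrib_left)
        moreover have "g + h \<in> J" "vars (a + b) \<subseteq> V"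
          using p q by (simp_all add: add_mem vars_add_subset)
        ultimately show ?thesis
          by blast
      qed
      show "b * p \<in> ?J" if b: "vars b \<subseteq> V" and p: "p \<in> ?J" for b p
      proof -
        obtain g a where ga: "p = g + (Var v - Const c) * a" "g \<in> J" "vars a \<subseteq> V"
          using p by blast
        have "b * p = b * g + (Var v - Const c) * (b * a)"
          by (simp add: ga(1) distrib_left mult.left_commute)
        moreover have "b * g \<in> J" "vars (b * a) \<subseteq> V"
          using b ga by (simp_all add: mult_mem vars_mult_subset)
        ultimately show ?thesis
          by blast
      qed
    qed
    then have J: "poly_ideal V ?J"
      by (rule poly_ideal.intro)
    have sub: "J \<subseteq> ?J"
    proof
      fix g assume "g \<in> J"
      then show "g \<in> ?J"
        by (intro CollectI exI[of _ g] exI[of _ 0]) simp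
    qed
    have mem: "Var v - Const c \<in> ?J"
      using zero_mem by (intro CollectI exI[of _ 0] exI[of _ 1]) simp
    have "f \<in> ?J"
    proof (rule insert.IH[OF _ J])
      show "f \<in> J'" if "poly_ideal V J'" "?J \<subseteq> J'" "\<And>w. w \<in> W \<Longrightarrow> Var w - Const (a w) \<in> J'" for a J'
      proof (rule insert.prems(4)[OF that(1), of "a(v := c)"])
        show "J \<subseteq> J'"
          using sub that(2) by (rule order.trans)
        show "Var w - Const ((a(v := c)) w) \<in> J'" if "w \<in> insert v W" for w
          using that \<open>?J \<subseteq> J'\<close> mem \<open>\<And>w. w \<in> W \<Longrightarrow> Var w - Const (a w) \<in> J'\<close> by auto
      qed
    next
      show "Var w ^ CARD('a) - Var w \<in> ?J" if "w \<in> W" for w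
        by (rule subsetD[OF sub]) (rule insert.prems(3), use that in simp)
    qed (use insert.prems(1) in simp)
    then show "\<exists>g a. g \<in> J \<and> vars a \<subseteq> V \<and> f = g + (Var v - Const c) * a"
      by blast
  qed (use insert.prems in auto)
qed

lemma comm_ring_hom_id: "comm_ring_hom (\<lambda>c::'a::comm_ring_1. c)"
  by standard auto

text \<open>
  At a point \<open>a\<close> every polynomial is congruent to its value. If \<open>a\<close> is a zero of \<open>J\<close>, then \<open>f\<close> is congruent to
  \<open>0\<close>; otherwise a nonzero constant, hence everything, lies in the ideal.
\<close>

lemma finite_field_nullstellensatz:
  fixes J :: "'a::{field, finite} mpoly set"
  assumes V: "finite V" and J: "poly_ideal V J" and eq: "\<And>v. v \<in> V \<Longrightarrow> Var v ^ CARD('a) - Var v \<in> J"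
    and f: "vars f \<subseteq> V"
    and zero: "\<And>a. (\<And>g. g \<in> J \<Longrightarrow> peval (\<lambda>c. c) a g = 0) \<Longrightarrow> peval (\<lambda>c. c) a f = 0"
  shows "f \<in> J"
proof (rule mem_of_mem_at_points[OF V subset_refl J eq])
  fix a :: "var \<Rightarrow> 'a" and J'
  assume J': "poly_ideal V J'" "J \<subseteq> J'" and lin: "\<And>v. v \<in> V \<Longrightarrow> Var v - Const (a v) \<in> J'"
  interpret poly_ideal V J' by (rule J')
  interpret C: comm_ring_hom "Const :: 'a \<Rightarrow> 'a mpoly" by (rule comm_ring_hom_Const)
  let ?e = "peval (\<lambda>c. c) a"
  interpret e: comm_ring_hom ?e by (rule comm_ring_hom_peval[OF comm_ring_hom_id])
  have cong: "p - Const (?e p) \<in> J'" if "vars p \<subseteq> V" for p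
    using that
  proof (induction rule: PolyR_induct)
    case (Const c)
    then show ?case by (simp add: peval_Const[OF comm_ring_hom_id] zero_mem)
  next
    case (Var v)
    then show ?case by (simp add: peval_Var[OF comm_ring_hom_id] lin)
  next
    case (add p q)
    then show ?case
      using add_mem[of "p - Const (?e p)" "q - Const (?e q)"]
      by (simp add: e.hom_add C.hom_add algebra_simps)
  next
    case (mult p q)
    then show ?case
      by (simp add: e.hom_mult C.hom_mult mult_cong_mem)
  qed
  show "f \<in> J'"
  proof (cases "\<forall>g\<in>J. ?e g = 0")
    case True
    then show ?thesis
      using cong[OF f] zero[of a] by simp
  next
    case False
    then obtain g where g: "g \<in> J" "?e g \<noteq> 0"
      by blast
    have "g \<in> J'" "g - Const (?e g) \<in> J'"
      using g(1) J'(2) cong[OF poly_ideal.vars_mem[OF J g(1)]] by auto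
    from diff_mem[OF this] have "Const (?e g) \<in> J'"
      by simp
    then have "(f * Const (inverse (?e g))) * Const (?e g) \<in> J'"
      using f by (intro mult_mem vars_mult_subset) simp_all
    also have "(f * Const (inverse (?e g))) * Const (?e g) = f"
      using g(2) by (simp add: mult.assoc flip: C.hom_mult)
    finally show ?thesis .
  qed
qed

section \<open>Points of low rank\<close>

text \<open>
  The exterior product of \<open>C\<close> with the \<open>t\<close>-th unit vector has coordinates \<open>\<pluset_minorus> C\<^sub>T\<^sub>-\<^sub>t\<close>, and it anticommutes
  with the exterior product by a row.
\<close>

lemma support_form_wedge:
  assumes fin: "finite S"
  shows "support_form u (\<lambda>T. if t \<in> T then (- 1) ^ sgn_idx t T * C (T - {t}) else 0) i S =
    (if t \<in> S then - ((- 1) ^ sgn_idx t S * support_form u C i (S - {t})) else 0)"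
proof (cases "t \<in> S")
  case True
  let ?D = "\<lambda>T. if t \<in> T then (- 1) ^ sgn_idx t T * C (T - {t}) else 0"
  have "support_form u ?D i S = (\<Sum>j\<in>S - {t}. (- 1) ^ sgn_idx j S * u i j * ?D (S - {j}))"
    unfolding support_form_def using fin True by (simp add: sum.remove[of S t])
  also have "\<dots> = (\<Sum>j\<in>S - {t}. - ((- 1) ^ sgn_idx t S *
      ((- 1) ^ sgn_idx j (S - {t}) * u i j * C (S - {t} - {j}))))"
  proof (rule sum.cong)
    fix j assume j: "j \<in> S - {t}"
    have "(- 1 :: 'a) ^ (sgn_idx j S + sgn_idx t (S - {j})) = - ((- 1) ^ (sgn_idx t S + sgn_idx j (S - {t})))"
      using j True sgn_idx_Diff[OF fin True, of j] sgn_idx_Diff[OF fin, of j t]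
      by (cases "t < j") (auto simp: power_add)
    moreover have "S - {j} - {t} = S - {t} - {j}"
      by auto
    moreover have "(- 1) ^ sgn_idx j S * u i j * ?D (S - {j}) =
        (- 1) ^ (sgn_idx j S + sgn_idx t (S - {j})) * (u i j * C (S - {j} - {t}))"
      using j True by (simp add: power_add mult_ac)
    ultimately show "(- 1) ^ sgn_idx j S * u i j * ?D (S - {j}) =
        - ((- 1) ^ sgn_idx t S * ((- 1) ^ sgn_idx j (S - {t}) * u i j * C (S - {t} - {j})))"
      by (simp only: power_add mult_minus_left mult.assoc)
  qed simp
  also have "\<dots> = - ((- 1) ^ sgn_idx t S * support_form u C i (S - {t}))"
    by (simp add: support_form_def sum_distrib_left sum_negf)
  finally show ?thesis
    using True by simp
qed (auto simp: support_form_def intro!: sum.neutral)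

text \<open>
  If some \<open>t\<close>-minor is nonzero, the \<open>t\<close>-minors with the same rows are a solution. If not, the rank is smaller
  than \<open>t\<close>, and a solution one degree lower becomes one in degree \<open>t\<close> after multiplication with a unit
  vector outside a set at which it does not vanish.
\<close>

lemma ex_support_point:
  fixes u :: "nat \<Rightarrow> nat \<Rightarrow> 'b::idom"
  assumes "t \<le> n" "\<And>I J. I \<in> \<P> (t + 1) m \<Longrightarrow> J \<in> \<P> (t + 1) n \<Longrightarrow> set_minor u I J = 0"
  shows "\<exists>C. (\<exists>T\<in>\<P> t n. C T \<noteq> 0) \<and> (\<forall>i\<in>{1..m}. \<forall>S\<in>\<P> (t + 1) n. support_form u C i S = 0)"
  using assms
proof (induction t)
  case 0
  show ?case
  proof (intro exI[of _ "set_minor u {}"] conjI bexI[of _ "{}"] ballI)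
    fix i S assume "i \<in> {1..m}" "S \<in> \<P> (0 + 1) n"
    then show "support_form u (set_minor u {}) i S = 0"
      using 0(2)[of "{i}" S] support_form_set_minor_border[of "{}" i S u] finite_subset[of S "{1..n}"]
      by (simp add: subsets_of_card_def)
  qed (auto simp: set_minor_def subsets_of_card_def det_def)
next
  case (Suc t)
  show ?case
  proof (cases "\<exists>I\<in>\<P> (Suc t) m. \<exists>J\<in>\<P> (Suc t) n. set_minor u I J \<noteq> 0")
    case True
    then obtain I J where IJ: "I \<in> \<P> (Suc t) m" "J \<in> \<P> (Suc t) n" "set_minor u I J \<noteq> 0"
      by blast
    have "support_form u (set_minor u I) i S = 0" if i: "i \<in> {1..m}" and S: "S \<in> \<P> (Suc t + 1) n" for i S
    proof -
      have fin: "finite I" "finite S" and card: "card S = Suc (card I)"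
        using IJ(1) S by (auto simp: subsets_of_card_def intro: finite_subset)
      show ?thesis
      proof (cases "i \<in> I")
        case True
        then show ?thesis
          using fin card by (simp add: support_form_set_minor_zero)
      next
        case False
        then have "insert i I \<in> \<P> (Suc t + 1) m"
          using IJ(1) i fin by (auto simp: subsets_of_card_def)
        then show ?thesis
          using Suc.prems(2)[OF _ S] support_form_set_minor_border[OF fin(1) False fin(2) card, of u] by simp
      qed
    qed
    then show ?thesis
      using IJ by blast
  next
    case False
    then have "\<exists>C. (\<exists>T\<in>\<P> t n. C T \<noteq> 0) \<and> (\<forall>i\<in>{1..m}. \<forall>S\<in>\<P> (t + 1) n. support_form u C i S = 0)"
      using Suc.prems(1) by (intro Suc.IH) (simp_all add: Suc_eq_plus1)
    then obtain C T where C: "T \<in> \<P> t n" "C T \<noteq> 0"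
      "\<And>i S. i \<in> {1..m} \<Longrightarrow> S \<in> \<P> (t + 1) n \<Longrightarrow> support_form u C i S = 0"
      by blast
    have T: "T \<subseteq> {1..n}" "card T = t" "finite T"
      using C(1) by (auto simp: subsets_of_card_def intro: finite_subset)
    have "T \<noteq> {1..n}"
      using T(2) Suc.prems(1) by auto
    then obtain s where s: "s \<in> {1..n}" "s \<notin> T"
      using T(1) by blast
    let ?D = "\<lambda>T. if s \<in> T then (- 1) ^ sgn_idx s T * C (T - {s}) else 0"
    have ins: "insert s T \<in> \<P> (Suc t) n" "?D (insert s T) \<noteq> 0"
      using s T C(2) by (auto simp: subsets_of_card_def)
    have D: "support_form u ?D i S = 0" if "i \<in> {1..m}" "S \<in> \<P> (Suc t + 1) n" for i S
    proof -
      have "finite S"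
        using that(2) by (auto simp: subsets_of_card_def intro: finite_subset)
      moreover have "support_form u C i (S - {s}) = 0" if "s \<in> S"
        using \<open>i \<in> {1..m}\<close> \<open>S \<in> \<P> (Suc t + 1) n\<close> that by (intro C(3)) (auto simp: subsets_of_card_def)
      ultimately show ?thesis
        by (simp add: support_form_wedge)
    qed
    show ?thesis
      by (intro exI[of _ ?D] conjI bexI[OF _ ins(1)] ballI ins(2) D)
  qed
qed

section \<open>Colon ideals over a finite field\<close>

lemma vars_Var_power_minus_Var: "v \<in> V \<Longrightarrow> vars (Var v ^ q - Var v) \<subseteq> V"
  by (intro vars_diff_subset vars_power_subset) simp_all

lemma (in poly_ideal) power_card_power_mem:
  assumes "Var v ^ q - Var v \<in> I" "v \<in> V"
  shows "Var v ^ (q ^ s) - Var v \<in> I"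
proof (induction s)
  case 0
  show ?case by (simp add: zero_mem)
next
  case (Suc s)
  have "(\<Prod>_<q. Var v ^ (q ^ s)) - (\<Prod>_<q. Var v) \<in> I"
    using Suc assms(2) by (intro prod_cong_mem conjI vars_power_subset) auto
  then have "(Var v ^ (q ^ Suc s) - Var v ^ q) + (Var v ^ q - Var v) \<in> I"
    using assms(1) by (intro add_mem) (simp_all add: power_mult mult.commute flip: power_mult)
  then show ?case
    by simp
qed

context
  fixes k m n r :: nat and M :: "nat \<Rightarrow> 'a::{field, finite} mat"
  assumes r: "r \<le> n"
begin

abbreviation (input) x_eqs :: "'a mpoly set"
  where "x_eqs \<equiv> {Var (XV i) ^ CARD('a) - Var (XV i) |i. i \<in> {1..k}}"

abbreviation (input) C_eqs :: "'a mpoly set"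
  where "C_eqs \<equiv> {Var (CV T) ^ CARD('a) - Var (CV T) |T. T \<in> \<P> r n}"

abbreviation (input) Gb_vars :: "var set"
  where "Gb_vars \<equiv> XV ` {1..k} \<union> CV ` \<P> r n"

definition minors_field :: "'a mpoly set"
  where "minors_field = I_minors k m n r M <+>\<^bsub>PolyR (XV ` {1..k})\<^esub> Idl\<^bsub>PolyR (XV ` {1..k})\<^esub> x_eqs"

definition Gb_field :: "'a mpoly set"
  where "Gb_field = I_suppGb k m n r M <+>\<^bsub>PolyR Gb_vars\<^esub> Idl\<^bsub>PolyR Gb_vars\<^esub> (x_eqs \<union> C_eqs)"

lemma vars_x_eqs: "g \<in> x_eqs \<Longrightarrow> XV ` {1..k} \<subseteq> V \<Longrightarrow> vars g \<subseteq> V"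
  by (elim CollectE exE conjE ssubst) (intro vars_Var_power_minus_Var subsetD[of "XV ` {1..k}" V] imageI)

lemma vars_eqs: "g \<in> x_eqs \<union> C_eqs \<Longrightarrow> vars g \<subseteq> Gb_vars"
  by (elim UnE CollectE exE conjE ssubst) (rule vars_Var_power_minus_Var, simp)+

lemma poly_ideal_x_eqs: "poly_ideal (XV ` {1..k}) (Idl\<^bsub>PolyR (XV ` {1..k})\<^esub> x_eqs)"
  by (rule poly_ideal_genideal) (rule vars_x_eqs[OF _ subset_refl])

lemma poly_ideal_eqs: "poly_ideal Gb_vars (Idl\<^bsub>PolyR Gb_vars\<^esub> (x_eqs \<union> C_eqs))"
  by (rule poly_ideal_genideal) (rule vars_eqs)

lemma poly_ideal_minors_field: "poly_ideal (XV ` {1..k}) minors_field"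
  unfolding minors_field_def by (intro poly_ideal_sum poly_ideal_minors poly_ideal_x_eqs)

lemma poly_ideal_Gb_field: "poly_ideal Gb_vars Gb_field"
  unfolding Gb_field_def by (intro poly_ideal_sum poly_ideal_suppGb poly_ideal_eqs)

lemma I_minors_subset_minors_field: "I_minors k m n r M \<subseteq> minors_field"
  using poly_ideal.zero_mem[OF poly_ideal_x_eqs]
  unfolding minors_field_def ideal_sum_eq by force

lemma x_eqs_subset_minors_field: "x_eqs \<subseteq> minors_field"
proof
  fix g assume "g \<in> x_eqs"
  then have "g \<in> Idl\<^bsub>PolyR (XV ` {1..k})\<^esub> x_eqs"
    by (rule genideal_mem[rotated]) (rule vars_x_eqs[OF _ subset_refl])
  then show "g \<in> minors_field"
    using poly_ideal.zero_mem[OF poly_ideal_minors[of k m n r M]]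
    unfolding minors_field_def ideal_sum_eq by force
qed

lemma I_suppGb_subset_Gb_field: "I_suppGb k m n r M \<subseteq> Gb_field"
  using poly_ideal.zero_mem[OF poly_ideal_eqs]
  unfolding Gb_field_def ideal_sum_eq by force

lemma eqs_subset_Gb_field: "x_eqs \<union> C_eqs \<subseteq> Gb_field"
proof
  fix g assume "g \<in> x_eqs \<union> C_eqs"
  then have "g \<in> Idl\<^bsub>PolyR Gb_vars\<^esub> (x_eqs \<union> C_eqs)"
    by (rule genideal_mem[rotated]) (rule vars_eqs)
  then show "g \<in> Gb_field"
    using poly_ideal.zero_mem[OF poly_ideal_suppGb[of k r n m M]]
    unfolding Gb_field_def ideal_sum_eq by force
qed

text \<open>
  Since \<open>C\<^sub>T\<close> is congruent to its power with exponent \<open>q\<^sup>r\<^sup>+\<^sup>1 \<ge> r + 1\<close>, the product with \<open>C\<^sub>T\<close> inherits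
  membership from the product with \<open>C\<^sub>T\<^sup>r\<^sup>+\<^sup>1\<close>.
\<close>

lemma C_mult_I_minors_mem:
  assumes T: "T \<in> \<P> r n" and g: "g \<in> I_minors k m n r M"
  shows "g * Var (CV T) \<in> Gb_field"
proof -
  interpret Gb: poly_ideal Gb_vars Gb_field by (rule poly_ideal_Gb_field)
  let ?C = "Var (CV T) :: 'a mpoly" and ?N = "CARD('a) ^ (r + 1)"
  have "2 \<le> CARD('a)"
    using card_mono[of UNIV "{0, 1 :: 'a}"] by simp
  then have "2 ^ (r + 1) \<le> ?N"
    by (rule power_mono) simp
  then have N: "?N = (?N - (r + 1)) + (r + 1)"
    using less_exp[of "r + 1"] by linarith
  have g_vars: "vars g \<subseteq> Gb_vars"
    using poly_ideal.vars_mem[OF poly_ideal_minors g] by blast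
  have C_vars: "vars (?C ^ e) \<subseteq> Gb_vars" for e
    using T by (intro vars_power_subset) simp
  have "?C ^ CARD('a) - ?C \<in> Gb_field"
    using T eqs_subset_Gb_field by blast
  then have "?C ^ ?N - ?C \<in> Gb_field"
    using T by (intro Gb.power_card_power_mem) auto
  then have "g * (?C ^ ?N - ?C) \<in> Gb_field"
    by (rule Gb.mult_mem[OF g_vars])
  moreover have "?C ^ (r + 1) * g \<in> Gb_field"
    using power_mult_I_minors_mem[OF T g] I_suppGb_subset_Gb_field by blast
  then have "?C ^ (?N - (r + 1)) * (?C ^ (r + 1) * g) \<in> Gb_field"
    by (rule Gb.mult_mem[OF C_vars])
  ultimately have "?C ^ (?N - (r + 1)) * (?C ^ (r + 1) * g) - g * (?C ^ ?N - ?C) \<in> Gb_field"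
    by (intro Gb.diff_mem)
  also have "?C ^ (?N - (r + 1)) * (?C ^ (r + 1) * g) = g * ?C ^ ?N"
    by (subst (2) N) (simp only: power_add mult_ac)
  finally show ?thesis
    by (simp add: right_diff_distrib)
qed

text \<open>
  Every generator of the left-hand side times every \<open>C\<^sub>T\<close> lies in the extended support ideal; the field
  equations of the \<open>x\<^sub>i\<close> are themselves among its generators.
\<close>

lemma minors_field_mult_mem:
  assumes f: "f \<in> minors_field" and c: "c \<in> Idl\<^bsub>PolyR Gb_vars\<^esub> {Var (CV T) |T. T \<in> \<P> r n}"
  shows "f * c \<in> Gb_field"
  using c
proof (induction rule: genideal_induct)
  interpret Gb: poly_ideal Gb_vars Gb_field by (rule poly_ideal_Gb_field)
  {
    case (vars g)
    then show ?case by auto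
  next
    case zero
    show ?case by (simp add: Gb.zero_mem)
  next
    case (gen c)
    then obtain T where T: "c = Var (CV T)" "T \<in> \<P> r n"
      by blast
    obtain g e where ge: "f = g + e" "g \<in> I_minors k m n r M" "e \<in> Idl\<^bsub>PolyR (XV ` {1..k})\<^esub> x_eqs"
      using f unfolding minors_field_def ideal_sum_eq by blast
    have "e \<in> Gb_field"
      using ge(3)
    proof (induction rule: genideal_induct)
      case (vars g)
      then show ?case by (rule vars_x_eqs[OF _ subset_refl])
    next
      case zero
      show ?case by (rule Gb.zero_mem)
    next
      case (gen g)
      then show ?case using eqs_subset_Gb_field by blast
    next
      case (add p q)
      then show ?case by (rule Gb.add_mem)
    next
      case (mult a p)
      then show ?case by (intro Gb.mult_mem le_supI1)
    qed
    then show ?case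
      using C_mult_I_minors_mem[OF T(2) ge(2)] T
      by (simp add: ge(1) T(1) distrib_right Gb.add_mem Gb.mult_mem_right)
  next
    case (add p q)
    then show ?case by (simp add: distrib_left Gb.add_mem)
  next
    case (mult a p)
    then show ?case
      using Gb.mult_mem[of a "f * p"] by (simp add: mult.left_commute)
  }
qed

lemma peval_Gb_field:
  fixes a :: "var \<Rightarrow> 'a"
  assumes h: "\<And>i S. i \<in> {1..m} \<Longrightarrow> S \<in> \<P> (r + 1) n \<Longrightarrow>
      peval (\<lambda>c. c) a (support_form (u_entry k m n M) (\<lambda>T. Var (CV T)) i S) = 0"
    and p: "p \<in> Gb_field"
  shows "peval (\<lambda>c. c) a p = 0"
proof -
  interpret e: comm_ring_hom "peval (\<lambda>c. c) a" by (rule comm_ring_hom_peval[OF comm_ring_hom_id])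
  obtain g e where ge: "p = g + e" "g \<in> I_suppGb k m n r M" "e \<in> Idl\<^bsub>PolyR Gb_vars\<^esub> (x_eqs \<union> C_eqs)"
    using p unfolding Gb_field_def ideal_sum_eq by blast
  have "peval (\<lambda>c. c) a g = 0"
    using ge(2) by (induction rule: I_suppGb_induct) (simp_all add: h e.hom_add e.hom_mult)
  moreover have "peval (\<lambda>c. c) a e = 0"
    using ge(3)
  proof (induction rule: genideal_induct)
    case (vars g)
    then show ?case by (rule vars_eqs)
  next
    case (gen g)
    then show ?case
      by (auto simp: e.hom_minus e.hom_power peval_Var[OF comm_ring_hom_id] power_card_eq_same)
  qed (simp_all add: e.hom_add e.hom_mult)
  ultimately show ?thesis
    by (simp add: ge(1) e.hom_add)
qed

text \<open>
  At a zero \<open>a\<close> of the ideal, the minors of \<open>u(a)\<close> of size \<open>r + 1\<close> vanish, so \<open>a\<close> extends by some \<open>C \<noteq> 0\<close> to a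
  zero \<open>b\<close> of the support relations.
\<close>

lemma mem_minors_field:
  assumes f: "vars f \<subseteq> XV ` {1..k}" and C: "\<And>T. T \<in> \<P> r n \<Longrightarrow> f * Var (CV T) \<in> Gb_field"
  shows "f \<in> minors_field"
proof (rule finite_field_nullstellensatz[OF _ poly_ideal_minors_field _ f])
  show "Var v ^ CARD('a) - Var v \<in> minors_field" if "v \<in> XV ` {1..k}" for v
    using that x_eqs_subset_minors_field by blast
  fix a :: "var \<Rightarrow> 'a"
  assume zero: "\<And>g. g \<in> minors_field \<Longrightarrow> peval (\<lambda>c. c) a g = 0"
  interpret e: comm_ring_hom "peval (\<lambda>c. c) a" by (rule comm_ring_hom_peval[OF comm_ring_hom_id])
  let ?u = "\<lambda>i j. peval (\<lambda>c. c) a (u_entry k m n M i j)"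
  have "set_minor ?u I J = 0" if "I \<in> \<P> (r + 1) m" "J \<in> \<P> (r + 1) n" for I J
    using zero set_minor_mem_I_minors[OF that, of k M] I_minors_subset_minors_field
    by (auto simp flip: e.hom_set_minor)
  then obtain C T where CT: "T \<in> \<P> r n" "C T \<noteq> 0"
    and h: "\<And>i S. i \<in> {1..m} \<Longrightarrow> S \<in> \<P> (r + 1) n \<Longrightarrow> support_form ?u C i S = 0"
    using ex_support_point[OF r, of m ?u] by blast
  \<comment> \<open>the point above \<open>a\<close>; it agrees with \<open>a\<close> on the \<open>x\<^sub>i\<close>\<close>
  define b where "b v = (case v of CV T \<Rightarrow> C T | _ \<Rightarrow> a v)" for v
  interpret b: comm_ring_hom "peval (\<lambda>c. c) b" by (rule comm_ring_hom_peval[OF comm_ring_hom_id])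
  have base: "peval (\<lambda>c. c) b p = peval (\<lambda>c. c) a p" if "vars p \<subseteq> XV ` {1..k}" for p
    using that by (intro peval_cong) (auto simp: b_def)
  have "peval (\<lambda>c. c) b (f * Var (CV T)) = 0"
  proof (rule peval_Gb_field[OF _ C[OF CT(1)]])
    fix i S assume iS: "i \<in> {1..m}" "S \<in> \<P> (r + 1) n"
    then have "peval (\<lambda>c. c) b (u_entry k m n M i j) = ?u i j" if "j \<in> S" for j
      using that by (intro base vars_u_entry) (auto simp: subsets_of_card_def)
    then have "peval (\<lambda>c. c) b (support_form (u_entry k m n M) (\<lambda>T. Var (CV T)) i S) = support_form ?u C i S"
      unfolding b.hom_support_form unfolding support_form_def
      by (intro sum.cong) (simp_all add: peval_Var[OF comm_ring_hom_id] b_def)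
    then show "peval (\<lambda>c. c) b (support_form (u_entry k m n M) (\<lambda>T. Var (CV T)) i S) = 0"
      by (simp add: h[OF iS])
  qed
  then show "peval (\<lambda>c. c) a f = 0"
    using CT(2) by (simp add: b.hom_mult base[OF f] peval_Var[OF comm_ring_hom_id] b_def)
qed simp

lemma minors_field_eq_colon:
  "minors_field = ideal_quot (R_suppGb k n r) Gb_field
      (Idl\<^bsub>R_suppGb k n r\<^esub> {Var (CV T) |T. T \<in> \<P> r n}) \<inter> carrier (R_base k)"
proof (intro equalityI subsetI)
  fix f assume f: "f \<in> minors_field"
  then have "vars f \<subseteq> XV ` {1..k}"
    by (rule poly_ideal.vars_mem[OF poly_ideal_minors_field])
  then show "f \<in> ideal_quot (R_suppGb k n r) Gb_field
      (Idl\<^bsub>R_suppGb k n r\<^esub> {Var (CV T) |T. T \<in> \<P> r n}) \<inter> carrier (R_base k)"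
    using minors_field_mult_mem[OF f]
    by (auto simp: ideal_quot_def R_suppGb_def R_base_def carrier_PolyR)
next
  fix f assume "f \<in> ideal_quot (R_suppGb k n r) Gb_field
      (Idl\<^bsub>R_suppGb k n r\<^esub> {Var (CV T) |T. T \<in> \<P> r n}) \<inter> carrier (R_base k)"
  then have f: "vars f \<subseteq> XV ` {1..k}"
    and mult: "\<And>c. c \<in> Idl\<^bsub>PolyR Gb_vars\<^esub> {Var (CV T) |T. T \<in> \<P> r n} \<Longrightarrow> f * c \<in> Gb_field"
    by (simp_all add: ideal_quot_def R_suppGb_def R_base_def carrier_PolyR)
  show "f \<in> minors_field"
  proof (rule mem_minors_field[OF f mult])
    show "Var (CV T) \<in> Idl\<^bsub>PolyR Gb_vars\<^esub> {Var (CV T) |T. T \<in> \<P> r n}" if "T \<in> \<P> r n" for T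
      by (rule genideal_mem) (use that in auto)
  qed
qed

end

theorem theorem1p1:
  fixes k m n r :: nat
    and M :: "nat \<Rightarrow> 'a::{field, finite} mat"
  assumes "k > 0" and "m > 0" and "n > 0" and "r > 0"
    and "r < min m n"
    and "\<And>l. l \<in> {1..k} \<Longrightarrow> M l \<in> carrier_mat m n"
  shows
    "(I_minors k m n r M \<subseteq> I_KS k m n r M \<inter> carrier (R_base k) \<and>
      (\<forall>I\<in>\<P> r m. \<forall>\<Delta>. \<Delta> = minor k m n M I (T0 n r) \<and> \<Delta> \<noteq> 0 \<longrightarrow>
        localise \<Delta> (I_minors k m n r M) =
          localise \<Delta> (I_KS k m n r M) \<inter> localise \<Delta> (carrier (R_base k)))) \<and>
     ((\<exists>\<Phi>::'a mpoly \<Rightarrow> 'a mpoly. is_Phi k n r \<Phi>) \<and>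
      (\<forall>\<Phi>. is_Phi k n r \<Phi> \<longrightarrow>
        \<Phi> ` (I_supp k m n r M \<inter> carrier (R_supp_tilde k n r)) = I_KS k m n r M)) \<and>
     ((\<forall>T\<in>\<P> r n. (\<lambda>f. Var (CV T) ^ (r + 1) * f) ` I_minors k m n r M \<subseteq> I_suppGb k m n r M) \<and>
      I_minors k m n r M
        <+>\<^bsub>R_base k\<^esub> Idl\<^bsub>R_base k\<^esub> {Var (XV i) ^ CARD('a) - Var (XV i) |i. i \<in> {1..k}} =
      ideal_quot (R_suppGb k n r)
        (I_suppGb k m n r M
          <+>\<^bsub>R_suppGb k n r\<^esub>
            Idl\<^bsub>R_suppGb k n r\<^esub>
              ({Var (XV i) ^ CARD('a) - Var (XV i) |i. i \<in> {1..k}} \<union>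
               {Var (CV T) ^ CARD('a) - Var (CV T) |T. T \<in> \<P> r n}))
        (Idl\<^bsub>R_suppGb k n r\<^esub> {Var (CV T) |T. T \<in> \<P> r n})
      \<inter> carrier (R_base k))"
proof -
  have r: "r \<le> n"
    using assms by simp
  have base: "I_minors k m n r M \<subseteq> I_KS k m n r M \<inter> carrier (R_base k)"
    using I_minors_subset_I_KS[OF r] poly_ideal.vars_mem[OF poly_ideal_minors]
    unfolding R_base_def carrier_PolyR by blast
  have loc: "\<forall>I\<in>\<P> r m. \<forall>\<Delta>. \<Delta> = minor k m n M I (T0 n r) \<and> \<Delta> \<noteq> 0 \<longrightarrow>
      localise \<Delta> (I_minors k m n r M) =
        localise \<Delta> (I_KS k m n r M) \<inter> localise \<Delta> (carrier (R_base k))"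
    using localise_I_minors[OF r] minor_eq_set_minor[OF _ T0_mem[OF r]] by metis
  have "\<exists>\<Phi>::'a mpoly \<Rightarrow> 'a mpoly. is_Phi k n r \<Phi>"
    using is_Phi_KS_subst[OF r] by blast
  moreover have "\<forall>\<Phi>. is_Phi k n r \<Phi> \<longrightarrow>
      \<Phi> ` (I_supp k m n r M \<inter> carrier (R_supp_tilde k n r)) = I_KS k m n r M"
    using Phi_image_I_supp[OF r] by blast
  moreover have "\<forall>T\<in>\<P> r n. (\<lambda>f. Var (CV T) ^ (r + 1) * f) ` I_minors k m n r M \<subseteq> I_suppGb k m n r M"
    using power_mult_I_minors_mem by blast
  moreover note minors_field_eq_colon[OF r, unfolded minors_field_def[OF r] Gb_field_def[OF r], of k m M,
      folded R_base_def R_suppGb_def]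
  ultimately show ?thesis
    using base loc by (intro conjI)
qed

end
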